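(* Let $A$ be a unital semi-simple commutative Banach algebra, $U$ an automorphism of $A$ with induced homeomorphism $\varphi$, and $w \in A$. Let $T = wU$ and let $\check{T}$ be the associated weighted composition operator on $\check{A}$. Assume that $U^n \neq I$ for all $n \in \mathbb{N}$ and that $\sigma(\check{T}) \subseteq \mathbb{T}$. Assume additionally that $\partial A$ contains no $\varphi$-periodic points and that every point of $\partial A$ is a peak point for the algebra $\check{A}$. Then $\mathbb{T} \subseteq \sigma(T)$.
   Context: $A$ is a unital commutative semi-simple Banach algebra with maximal ideal space $\mathfrak{M}_A$ and Shilov boundary $\partial A$. For $f\in A$, $\check f$ is the restriction of the Gelfand transform $\hat f$ to $\partial A$; $\check A$ is the closure of $\{\check f : f\in A\}$ in $C(\partial A)$ with sup norm. The automorphism $U$ induces a homeomorphism $\varphi$ of $\mathfrak{M}_A$ by $\widehat{Uf}(m)=\hat f(\varphi(m))$, and $\varphi(\partial A)=\partial A$. $T=wU$ means $Tf=w\cdot Uf$; $\check T$ is the operator on $\check A$ given by $(\check Tg)(t)=\check w(t)g(\varphi(t))$, $t\in\partial A$. A point $t\in\partial A$ is $\varphi$-periodic if $\varphi^n(t)=t$ for some $n\in\mathbb{N}$. A point $t\in\partial A$ is a peak point for $\check A$ if there is $g\in\check A$ with $g(t)=1$ and $|g(s)|<1$ for all $s\in\partial A$, $s\neq t$. $\mathbb{T}$ is the unit circle. *)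

theory Defs
  imports "HOL-Analysis.Analysis"
begin

text \<open>A unital commutative complex Banach algebra is modelled as a type of class
  real_normed_algebra_1, comm_ring_1, banach together with a distinguished element j
  (playing the role of i times the unit) with j * j = -1, such that the induced complex
  scalar multiplication is norm-homogeneous.\<close>

definition cscale :: "'a::real_normed_algebra_1 \<Rightarrow> complex \<Rightarrow> 'a \<Rightarrow> 'a" where
  "cscale j c x = Re c *\<^sub>R x + Im c *\<^sub>R (j * x)"

definition complex_banach_alg :: "'a::{real_normed_algebra_1,comm_ring_1,banach} \<Rightarrow> bool" where
  "complex_banach_alg j \<longleftrightarrow> j * j = -1 \<and> (\<forall>c x. norm (cscale j c x) = cmod c * norm x)"

text \<open>Maximal ideal space: the characters (nonzero multiplicative complex-linear functionals),
  carrying the Gelfand (weak-star) topology, i.e. the subspace topology of the product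
  topology on 'a => complex. The Gelfand transform of f is evaluation m |-> m f.\<close>

definition characters :: "'a::{real_normed_algebra_1,comm_ring_1,banach} \<Rightarrow> ('a \<Rightarrow> complex) set" where
  "characters j = {m. m 1 = 1 \<and> (\<forall>x y. m (x + y) = m x + m y) \<and> (\<forall>x y. m (x * y) = m x * m y)
                      \<and> (\<forall>c x. m (cscale j c x) = c * m x)}"

text \<open>Semi-simple: the Jacobson radical (= kernel of the Gelfand transform) is zero.\<close>
definition semisimple :: "'a::{real_normed_algebra_1,comm_ring_1,banach} \<Rightarrow> bool" where
  "semisimple j \<longleftrightarrow> (\<forall>f. (\<forall>m\<in>characters j. m f = 0) \<longrightarrow> f = 0)"

definition algebra_automorphism :: "'a::{real_normed_algebra_1,comm_ring_1,banach} \<Rightarrow> ('a \<Rightarrow> 'a) \<Rightarrow> bool" where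
  "algebra_automorphism j U \<longleftrightarrow> bij U \<and> U 1 = 1 \<and> (\<forall>x y. U (x + y) = U x + U y)
      \<and> (\<forall>x y. U (x * y) = U x * U y) \<and> (\<forall>c x. U (cscale j c x) = cscale j c (U x))"

text \<open>The induced map on the maximal ideal space: (Uf)^(m) = f^(phi m), i.e. phi m = m o U.\<close>
definition induced_map :: "('a \<Rightarrow> 'a) \<Rightarrow> ('a \<Rightarrow> complex) \<Rightarrow> ('a \<Rightarrow> complex)" where
  "induced_map U m = m \<circ> U"

definition is_boundary :: "'a::{real_normed_algebra_1,comm_ring_1,banach} \<Rightarrow> ('a \<Rightarrow> complex) set \<Rightarrow> bool" where
  "is_boundary j B \<longleftrightarrow> B \<subseteq> characters j \<and>
     (\<forall>f. \<exists>m\<in>B. \<forall>m'\<in>characters j. cmod (m' f) \<le> cmod (m f))"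

definition shilov_boundary :: "'a::{real_normed_algebra_1,comm_ring_1,banach} \<Rightarrow> ('a \<Rightarrow> complex) set" where
  "shilov_boundary j = \<Inter> {B. closed B \<and> is_boundary j B}"

text \<open>The algebra A-check: sup-norm closure in C(dA) of the restrictions of Gelfand transforms
  to the Shilov boundary. Elements are represented as functions vanishing off dA.\<close>
definition check_algebra :: "'a::{real_normed_algebra_1,comm_ring_1,banach} \<Rightarrow> (('a \<Rightarrow> complex) \<Rightarrow> complex) set" where
  "check_algebra j = {g. (\<forall>t. t \<notin> shilov_boundary j \<longrightarrow> g t = 0) \<and>
      (\<forall>e>0. \<exists>f. \<forall>t\<in>shilov_boundary j. cmod (g t - t f) < e)}"

definition check_op :: "'a::{real_normed_algebra_1,comm_ring_1,banach} \<Rightarrow> ('a \<Rightarrow> 'a) \<Rightarrow> 'a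
     \<Rightarrow> (('a \<Rightarrow> complex) \<Rightarrow> complex) \<Rightarrow> (('a \<Rightarrow> complex) \<Rightarrow> complex)" where
  "check_op j U w g = (\<lambda>t. if t \<in> shilov_boundary j then t w * g (induced_map U t) else 0)"

definition alg_spectrum :: "'a::{real_normed_algebra_1,comm_ring_1,banach} \<Rightarrow> ('a \<Rightarrow> 'a) \<Rightarrow> complex set" where
  "alg_spectrum j T = {c. \<not> bij (\<lambda>x. T x - cscale j c x)}"

definition check_spectrum :: "'a::{real_normed_algebra_1,comm_ring_1,banach} \<Rightarrow> ('a \<Rightarrow> 'a) \<Rightarrow> 'a \<Rightarrow> complex set" where
  "check_spectrum j U w = {c. \<not> bij_betw (\<lambda>g t. check_op j U w g t - c * g t)
                                   (check_algebra j) (check_algebra j)}"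

definition periodic_point :: "('a \<Rightarrow> 'a) \<Rightarrow> ('a \<Rightarrow> complex) \<Rightarrow> bool" where
  "periodic_point U t \<longleftrightarrow> (\<exists>n\<ge>1. (induced_map U ^^ n) t = t)"

definition peak_point :: "'a::{real_normed_algebra_1,comm_ring_1,banach} \<Rightarrow> ('a \<Rightarrow> complex) \<Rightarrow> bool" where
  "peak_point j t \<longleftrightarrow> (\<exists>g\<in>check_algebra j. g t = 1 \<and>
      (\<forall>s\<in>shilov_boundary j. s \<noteq> t \<longrightarrow> cmod (g s) < 1))"

end

theory Submission
  imports Defs "HOL-Complex_Analysis.Conformal_Mappings" "HOL-Probability.Discrete_Topology"
begin

text \<open>
  On the Shilov boundary \<open>w\<close> has no zeros, and there is a point \<open>t\<close> whose two-sided cocycle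
  \<open>w(t) w(\<phi> t) \<cdots> w(\<phi>\<^sup>n\<^sup>-\<^sup>1 t)\<close> (with reciprocals for negative \<open>n\<close>) is bounded by \<open>r\<^sup>n\<close> for all
  integers \<open>n\<close>, where \<open>r\<close> is the maximal growth rate. Along the orbit of \<open>t\<close> the equation
  \<open>(T - \<lambda>) g = f\<close> becomes a scalar recurrence, so \<open>\<bar>g(t)\<bar> \<le> sup \<bar>f\<bar> / \<bar>\<bar>\<lambda>\<bar> - r\<bar>\<close>. If \<open>f\<close> peaks at \<open>t\<close> and
  is small on a long piece of the (aperiodic) orbit, then \<open>g(t)\<close> is close to \<open>-1/\<lambda>\<close> for \<open>\<bar>\<lambda>\<bar> > r\<close> and
  close to \<open>0\<close> for \<open>\<bar>\<lambda>\<bar> < r\<close>.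

  If \<open>r \<noteq> 1\<close>, then the resolvent of the boundary operator is bounded in the sup norm near \<open>r\<close>, hence
  Lipschitz there, contradicting this jump. If \<open>r = 1\<close> and \<open>\<bar>\<lambda>\<^sub>0\<bar> = 1\<close> lies outside the spectrum of \<open>T\<close>,
  then \<open>g(t)\<close> is holomorphic in \<open>\<lambda>\<close> near \<open>\<lambda>\<^sub>0\<close>, although bounded there only in terms of the norm of \<open>f\<close> in
  \<open>A\<close>. Multiplying by a quadratic polynomial vanishing where a small circle around \<open>\<lambda>\<^sub>0\<close> crosses the unit
  circle (in logarithmic coordinates) and applying the maximum principle turns the estimate above
  into a bound by \<open>sup \<bar>f\<bar>\<close>, uniform near \<open>\<lambda>\<^sub>0\<close>, and the same jump is a contradiction.
\<close>

section \<open>Resolvent estimates\<close>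

text \<open>Closed graph theorem for a map that is linear only on a subspace given as a set. By
  Baire some sublevel set of \<open>norm (R x)\<close> is dense in a relatively open piece of
  \<open>S\<close>; differences and scaling move this piece to the origin, and a series of
  corrections makes the approximate bound exact.\<close>

lemma closed_graph_subspace_bounded:
  fixes R :: "'b::banach \<Rightarrow> 'c::banach"
  assumes S: "subspace S" "closed S"
    and add: "\<And>x y. x \<in> S \<Longrightarrow> y \<in> S \<Longrightarrow> R (x + y) = R x + R y"
    and scale: "\<And>r x. x \<in> S \<Longrightarrow> R (r *\<^sub>R x) = r *\<^sub>R R x"
    and graph: "\<And>X g. (\<And>n. X n \<in> S) \<Longrightarrow> X \<longlonglongrightarrow> 0 \<Longrightarrow> (\<lambda>n. R (X n)) \<longlonglongrightarrow> g \<Longrightarrow> g = 0"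
  shows "\<exists>M>0. \<forall>x\<in>S. norm (R x) \<le> M * norm x"
proof -
  have diff: "R (x - y) = R x - R y" if "x \<in> S" "y \<in> S" for x y
    using add[of x "(-1) *\<^sub>R y"] scale[of y "-1"] that S by (simp add: subspace_scale subspace_neg)
  have R0: "R 0 = 0"
    using scale[of 0 0] S by (simp add: subspace_0)
  define F where "F n = {x \<in> S. norm (R x) \<le> real n}" for n :: nat
  have FS: "closure (F n) \<subseteq> S" for n
    unfolding F_def by (rule closure_minimal) (use S in auto)
  have Un: "(\<Union>n. closure (F n)) = S"
  proof
    show "S \<subseteq> (\<Union>n. closure (F n))"
    proof
      fix x assume "x \<in> S"
      obtain n :: nat where "norm (R x) \<le> real n"
        using real_arch_simple by blast
      then have "x \<in> F n" using \<open>x \<in> S\<close> by (simp add: F_def)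
      then show "x \<in> (\<Union>n. closure (F n))" using closure_subset by blast
    qed
  qed (use FS in blast)
  have "\<exists>n. top_of_set S interior_of closure (F n) \<noteq> {}"
  proof (rule ccontr)
    assume "\<not> ?thesis"
    then have "top_of_set S interior_of \<Union>(range (\<lambda>n. closure (F n))) = {}"
      using S FS
      by (intro Baire_category_alt disjI1 completely_metrizable_space_closedin
            completely_metrizable_space_euclidean)
         (auto simp: closedin_closed_eq)
    then have "top_of_set S interior_of S = {}"
      using Un by simp
    then show False
      using S subspace_0[of S] by (metis empty_iff interior_of_topspace topspace_euclidean_subtopology)
  qed
  then obtain n x0 where "x0 \<in> top_of_set S interior_of closure (F n)" by blast
  then obtain W where W: "openin (top_of_set S) W" "x0 \<in> W" "W \<subseteq> closure (F n)"
    unfolding interior_of_def by blast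
  then obtain e where e: "e > 0" "ball x0 e \<inter> S \<subseteq> W"
    unfolding openin_contains_ball by blast
  have x0: "x0 \<in> S"
    using W openin_subset by fastforce
  \<comment> \<open>Subtracting approximants of \<open>x0 + y\<close> and of \<open>x0\<close>
    recentres the ball at the origin at the price of doubling the bound \<open>n\<close>.\<close>
  have approx1: "\<exists>z\<in>S. norm (z - y) < d \<and> norm (R z) \<le> 2 * real n"
    if y: "y \<in> S" "norm y < e" and "d > 0" for y d
  proof -
    have "x0 + y \<in> closure (F n)"
      using W e y x0 S by (auto simp: subset_iff dist_norm subspace_add)
    then obtain p where p: "p \<in> F n" "dist p (x0 + y) < d/2"
      using \<open>d > 0\<close> unfolding closure_approachable by (meson half_gt_zero)
    have "x0 \<in> closure (F n)" using W by blast
    then obtain q where q: "q \<in> F n" "dist q x0 < d/2"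
      using \<open>d > 0\<close> unfolding closure_approachable by (meson half_gt_zero)
    have "norm (p - q - y) \<le> norm (p - (x0 + y)) + norm (q - x0)"
      using norm_triangle_ineq4[of "p - (x0 + y)" "q - x0"] by (simp add: algebra_simps)
    then have "norm (p - q - y) < d"
      using p q by (simp add: dist_norm)
    moreover have "norm (R (p - q)) \<le> 2 * real n"
      using p q norm_triangle_ineq4[of "R p" "R q"] by (simp add: F_def diff)
    moreover have "p - q \<in> S" using p q S by (simp add: F_def subspace_diff)
    ultimately show ?thesis by blast
  qed
  \<comment> \<open>Scaling \<open>y\<close> to norm \<open>e / 2\<close> and back turns the bound
    \<open>2 * n\<close> into \<open>(4 * n / e) * norm y\<close>; the summand 1 keeps
    \<open>K\<close> positive when \<open>n = 0\<close>.\<close>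
  define K where "K = 4 * real n / e + 1"
  have K: "K > 0" unfolding K_def using e by (simp add: add_nonneg_pos)
  have approx: "\<exists>z\<in>S. norm (z - y) < d \<and> norm (R z) \<le> K * norm y"
    if y: "y \<in> S" and "d > 0" for y d
  proof (cases "y = 0")
    case True
    then show ?thesis using \<open>d > 0\<close> R0 S by (intro bexI[of _ 0]) (auto simp: subspace_0)
  next
    case False
    define c where "c = e / (2 * norm y)"
    have c: "c > 0" using e False by (simp add: c_def)
    have "c *\<^sub>R y \<in> S" "norm (c *\<^sub>R y) < e"
      using y S e False by (auto simp: subspace_scale c_def)
    from approx1[OF this, of "c * d"] obtain z where z: "z \<in> S" "norm (z - c *\<^sub>R y) < c * d"
        "norm (R z) \<le> 2 * real n"
      using c \<open>d > 0\<close> by auto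
    have "norm ((1/c) *\<^sub>R z - y) = norm ((1/c) *\<^sub>R (z - c *\<^sub>R y))"
      using c by (simp add: scaleR_diff_right)
    also have "\<dots> = norm (z - c *\<^sub>R y) / c"
      using c by (subst norm_scaleR) auto
    also have "\<dots> < d"
      using z c by (simp add: pos_divide_less_eq mult.commute)
    finally have 1: "norm ((1/c) *\<^sub>R z - y) < d" .
    have "norm (R ((1/c) *\<^sub>R z)) \<le> (1/c) * (2 * real n)"
      using z c by (simp add: scale field_simps)
    also have "\<dots> \<le> K * norm y"
      using e by (simp add: c_def K_def field_simps)
    finally show ?thesis
      using 1 z S by (intro bexI[of _ "(1/c) *\<^sub>R z"]) (auto simp: subspace_scale)
  qed
  define ch where "ch y d = (SOME z. z \<in> S \<and> norm (z - y) < d \<and> norm (R z) \<le> K * norm y)" for y d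
  have ch: "ch y d \<in> S \<and> norm (ch y d - y) < d \<and> norm (R (ch y d)) \<le> K * norm y"
    if "y \<in> S" "d > 0" for y d
    unfolding ch_def by (rule someI_ex) (use approx[OF that] in blast)
  have "norm (R x) \<le> (2 * K) * norm x" if x: "x \<in> S" for x
  proof (cases "x = 0")
    case False
    \<comment> \<open>\<open>y k\<close> is the residual of \<open>x\<close> after \<open>k\<close>
      corrections; the tolerances halve its bound each time, so the images of the corrections under
      \<open>R\<close> are summable.\<close>
    define y where "y = rec_nat x (\<lambda>k y. y - ch y (norm x / 2 ^ Suc k))"
    define z where "z k = ch (y k) (norm x / 2 ^ Suc k)" for k
    have y0: "y 0 = x" and ySuc: "y (Suc k) = y k - z k" for k
      by (simp_all add: y_def z_def)
    have d: "norm x / 2 ^ k > 0" for k using False by simp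
    have yS: "y k \<in> S \<and> norm (y k) \<le> norm x / 2 ^ k" for k
    proof (induction k)
      case (Suc k)
      with ch[of "y k", OF _ d[of "Suc k"]] S show ?case
        by (simp add: ySuc z_def subspace_diff norm_minus_commute less_imp_le)
    qed (simp add: y0 x)
    have z: "z k \<in> S" "norm (R (z k)) \<le> K * norm x * (1/2) ^ k" for k
    proof -
      show "z k \<in> S" using ch[of "y k", OF _ d[of "Suc k"]] yS by (simp add: z_def)
      have "norm (R (z k)) \<le> K * norm (y k)"
        using ch[of "y k", OF _ d[of "Suc k"]] yS by (simp add: z_def)
      also have "\<dots> \<le> K * (norm x / 2 ^ k)"
        using K yS by (intro mult_left_mono) auto
      finally show "norm (R (z k)) \<le> K * norm x * (1/2) ^ k"
        by (simp add: power_one_over)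
    qed
    have geo: "summable (\<lambda>k. K * norm x * (1/2::real) ^ k)"
      by (intro summable_mult summable_geometric) auto
    have summ: "summable (\<lambda>k. norm (R (z k)))"
      by (rule summable_comparison_test[OF _ geo]) (use z in auto)
    have part: "R (y k) = R x - (\<Sum>i<k. R (z i))" for k
      by (induction k) (auto simp: y0 ySuc diff yS z)
    have "(\<lambda>k. norm x / 2 ^ k) \<longlonglongrightarrow> 0"
      using tendsto_mult_right_zero[OF LIMSEQ_power_zero[of "1/2::real"], of "norm x"]
      by (simp add: power_one_over)
    then have y_lim: "y \<longlonglongrightarrow> 0"
      by (rule Lim_null_comparison[rotated]) (use yS in auto)
    have "(\<lambda>k. R x - (\<Sum>i<k. R (z i))) \<longlonglongrightarrow> R x - (\<Sum>i. R (z i))"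
      by (intro tendsto_diff tendsto_const summable_LIMSEQ summable_norm_cancel[OF summ])
    \<comment> \<open>The closed graph enters here: the residuals tend to 0 while their images
      converge, so the limit of the images is 0.\<close>
    then have "R x - (\<Sum>i. R (z i)) = 0"
      by (intro graph[OF _ y_lim]) (use yS in \<open>auto simp: part\<close>)
    then have "norm (R x) \<le> (\<Sum>i. norm (R (z i)))"
      using summable_norm[OF summ] by simp
    also have "\<dots> \<le> (\<Sum>k. K * norm x * (1/2::real) ^ k)"
      by (intro suminf_le summ geo z)
    also have "\<dots> = 2 * K * norm x"
      by (subst suminf_mult) (auto simp: suminf_geometric summable_geometric)
    finally show ?thesis .
  qed (simp add: R0)
  then show ?thesis using K by (intro exI[of _ "2 * K"]) auto
qed

text \<open>The bound is worthless near the two points of the circle on the imaginary axis, so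
  \<open>G\<close> is multiplied by a quadratic vanishing there. The odd part of the product has a
  zero at 0; dividing it by \<zeta> and applying the maximum principle yields an estimate linear in
  \<open>s\<close> that involves \<open>K\<close> but no supremum of \<open>G\<close>.\<close>

lemma holomorphic_odd_difference_bound:
  fixes G :: "complex \<Rightarrow> complex" and K :: real
  assumes hol: "G holomorphic_on ball 0 r" and \<rho>: "0 < \<rho>" "\<rho> < r"
    and bound: "\<And>\<zeta>. norm \<zeta> = \<rho> \<Longrightarrow> Re \<zeta> \<noteq> 0 \<Longrightarrow> norm (G \<zeta>) \<le> K / \<bar>Re \<zeta>\<bar>"
    and s: "0 < s" "s \<le> \<rho>"
  shows "norm (G (of_real s) - G (of_real (-s))) \<le> 4 * K * s / \<rho>\<^sup>2"
proof -
  define H where "H \<zeta> = (\<zeta>\<^sup>2 + of_real (\<rho>\<^sup>2)) * G \<zeta>" for \<zeta>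
  define E where "E \<zeta> = H \<zeta> - H (- \<zeta>)" for \<zeta>
  have K: "K \<ge> 0"
    using order_trans[OF norm_ge_zero bound[of "of_real \<rho>"]] \<rho> by (simp add: zero_le_divide_iff)
  have "(\<lambda>\<zeta>. G (- \<zeta>)) holomorphic_on ball 0 r"
    by (rule holomorphic_on_compose_gen[OF _ hol, unfolded o_def]) (auto intro!: holomorphic_intros)
  then have "E holomorphic_on ball 0 r"
    unfolding E_def H_def by (intro holomorphic_intros hol)
  then obtain h where h: "h holomorphic_on ball 0 r" "\<And>z. norm z < r \<Longrightarrow> E z = z * h z"
    by (rule Schwarz3) (auto simp: E_def)
  have H: "norm (H \<zeta>) \<le> 2 * \<rho> * K" if z: "norm \<zeta> = \<rho>" for \<zeta>
  proof -
    \<comment> \<open>On the circle of radius \<open>\<rho>\<close> one has \<open>\<rho>\<^sup>2 = \<zeta> * cnj \<zeta>\<close>, so the factor vanishes exactly like \<open>Re \<zeta>\<close>.\<close>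
    have "\<zeta>\<^sup>2 + of_real (\<rho>\<^sup>2) = \<zeta> * of_real (2 * Re \<zeta>)"
      using z complex_norm_square[of \<zeta>] complex_add_cnj[of \<zeta>]
      by (simp add: power2_eq_square flip: distrib_left)
    then have "norm (H \<zeta>) = 2 * \<rho> * (\<bar>Re \<zeta>\<bar> * norm (G \<zeta>))"
      using z by (simp add: H_def norm_mult)
    moreover have "\<bar>Re \<zeta>\<bar> * norm (G \<zeta>) \<le> K"
      using bound[OF z] K by (cases "Re \<zeta> = 0") (auto simp: field_simps)
    ultimately show ?thesis using \<rho> by (simp add: mult_left_mono)
  qed
  have "norm (h (of_real s)) \<le> 4 * K"
  proof (rule maximum_modulus_frontier[of h "cball 0 \<rho>"])
    show "h holomorphic_on interior (cball 0 \<rho>)"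
      using h(1) by (rule holomorphic_on_subset) (use \<rho> in auto)
    show "continuous_on (closure (cball 0 \<rho>)) h"
      by (rule holomorphic_on_imp_continuous_on, rule holomorphic_on_subset[OF h(1)]) (use \<rho> in auto)
    show "of_real s \<in> cball (0::complex) \<rho>" using s by simp
    fix z :: complex assume "z \<in> frontier (cball 0 \<rho>)"
    then have z: "norm z = \<rho>" by simp
    have "\<rho> * norm (h z) = norm (E z)"
      using h(2)[of z] z \<rho> by (simp add: norm_mult)
    also have "\<dots> \<le> norm (H z) + norm (H (- z))"
      unfolding E_def by (rule norm_triangle_ineq4)
    also have "\<dots> \<le> \<rho> * (4 * K)"
      using H[of z] H[of "-z"] z by simp
    finally show "norm (h z) \<le> 4 * K" using \<rho> by simp
  qed auto
  then have "norm (E (of_real s)) \<le> 4 * K * s"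
    using h(2)[of "of_real s"] s \<rho> by (simp add: norm_mult mult.commute)
  \<comment> \<open>At \<open>s\<close> and \<open>-s\<close> the quadratic factor takes the same
    value, at least \<open>\<rho>\<^sup>2\<close>, so the odd part controls the difference of
    \<open>G\<close> itself.\<close>
  moreover have "E (of_real s) = of_real (s\<^sup>2 + \<rho>\<^sup>2) * (G (of_real s) - G (of_real (-s)))"
    by (simp add: E_def H_def algebra_simps)
  then have "norm (E (of_real s)) = (s\<^sup>2 + \<rho>\<^sup>2) * norm (G (of_real s) - G (of_real (-s)))"
    by (simp only: norm_mult norm_of_real) simp
  moreover have "\<rho>\<^sup>2 * norm (G (of_real s) - G (of_real (-s)))
      \<le> (s\<^sup>2 + \<rho>\<^sup>2) * norm (G (of_real s) - G (of_real (-s)))"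
    by (intro mult_right_mono) auto
  ultimately have "\<rho>\<^sup>2 * norm (G (of_real s) - G (of_real (-s))) \<le> 4 * K * s" by linarith
  then show ?thesis using \<rho> by (simp add: field_simps)
qed

text \<open>The recurrence is read in its contracting direction: from \<open>n - 1\<close> to
  \<open>n\<close> if \<open>norm z < 1\<close>, from \<open>n + 1\<close> back to \<open>n\<close>
  if \<open>norm z > 1\<close>. The supremum \<open>B\<close>, finite because \<open>b\<close> is
  bounded, then satisfies an inequality in which it can be absorbed.\<close>

lemma bounded_recurrence_bound:
  fixes a b :: "int \<Rightarrow> complex"
  assumes rec: "\<And>n. a n = b (n + 1) - z * b n"
    and a: "\<And>n. norm (a n) \<le> K" and b: "bounded (range b)" and z: "norm z \<noteq> 1"
  shows "norm (b n) \<le> K / \<bar>norm z - 1\<bar>"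
proof -
  define B where "B = (SUP n. norm (b n))"
  have bdd: "bdd_above (range (\<lambda>n. norm (b n)))"
    using b by (auto simp: bounded_iff bdd_above_def)
  have B: "norm (b n) \<le> B" for n
    unfolding B_def by (rule cSUP_upper[OF _ bdd]) simp
  have "B \<le> K / \<bar>norm z - 1\<bar>"
  proof (cases "norm z < 1")
    case True
    have "norm (b n) \<le> K + norm z * B" for n
    proof -
      have "b n = a (n - 1) + z * b (n - 1)" using rec[of "n - 1"] by simp
      then have "norm (b n) \<le> norm (a (n - 1)) + norm z * norm (b (n - 1))"
        by (metis norm_mult norm_triangle_ineq)
      also have "\<dots> \<le> K + norm z * B"
        by (intro add_mono a mult_left_mono B) auto
      finally show ?thesis .
    qed
    then have "B \<le> K + norm z * B" unfolding B_def by (intro cSUP_least) auto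
    then show ?thesis using True by (simp add: field_simps)
  next
    case False
    then have z1: "norm z > 1" using z by simp
    have "norm (b n) \<le> (K + B) / norm z" for n
    proof -
      have "z * b n = b (n + 1) - a n" using rec[of n] by simp
      then have "norm z * norm (b n) \<le> norm (b (n + 1)) + norm (a n)"
        by (metis norm_mult norm_triangle_ineq4)
      also have "\<dots> \<le> B + K" by (intro add_mono a B)
      finally show ?thesis using z1 by (subst pos_le_divide_eq) (auto simp: mult.commute add.commute)
    qed
    then have "B \<le> (K + B) / norm z" unfolding B_def by (intro cSUP_least) auto
    then have "B * norm z \<le> K + B" using z1 by (subst (asm) pos_le_divide_eq) auto
    then show ?thesis using z1 by (simp add: field_simps)
  qed
  then show ?thesis using B[of n] by linarith
qed

text \<open>Only finitely many steps are controlled, because a peak function is made small only on a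
  finite piece of the orbit; the remainder \<open>q ^ N * x N\<close> is later made small by an a
  priori bound on \<open>x\<close>.\<close>

lemma geometric_recursion_bound:
  fixes x :: "nat \<Rightarrow> real"
  assumes q: "0 \<le> q" "q < 1" and \<eta>: "0 \<le> \<eta>"
    and rec: "\<And>i. i < N \<Longrightarrow> x i \<le> \<eta> + q * x (Suc i)"
  shows "x 0 \<le> \<eta> / (1 - q) + q ^ N * x N"
proof -
  have "x 0 \<le> \<eta> * (\<Sum>i<k. q ^ i) + q ^ k * x k" if "k \<le> N" for k
    using that
  proof (induction k)
    case (Suc k)
    have "q ^ k * x k \<le> q ^ k * (\<eta> + q * x (Suc k))"
      using Suc.prems q by (intro mult_left_mono rec) auto
    with Suc show ?case by (simp add: algebra_simps)
  qed simp
  from this[of N] have 1: "x 0 \<le> \<eta> * (\<Sum>i<N. q ^ i) + q ^ N * x N" by simp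
  have "(\<Sum>i<N. q ^ i) \<le> 1 / (1 - q)"
  proof -
    have "(\<Sum>i<N. q ^ i) = (1 - q ^ N) / (1 - q)"
      using q by (simp add: geometric_sum divide_simps) (simp add: algebra_simps)
    also have "\<dots> \<le> 1 / (1 - q)" using q by (intro divide_right_mono) auto
    finally show ?thesis .
  qed
  then have "\<eta> * (\<Sum>i<N. q ^ i) \<le> \<eta> * (1 / (1 - q))"
    by (intro mult_left_mono \<eta>)
  with 1 show ?thesis by simp
qed

text \<open>For an input \<open>a\<close> close to a unit mass at 0, the bounded solution of
  \<open>b (n + 1) - z * b n = a n\<close> has \<open>b 0\<close> close to \<open>-1/z\<close> if \<open>\<bar>z\<bar> > 1\<close> and close to 0 if \<open>\<bar>z\<bar> < 1\<close>.
  This jump rules out a Lipschitz dependence on \<open>z\<close> that is uniform over such inputs.\<close>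

lemma resolvent_jump_contradiction:
  fixes P :: "(int \<Rightarrow> complex) \<Rightarrow> bool"
  assumes peaks: "\<And>N \<eta>. 0 < \<eta> \<Longrightarrow> \<exists>a. P a \<and> norm (a 0 - 1) \<le> \<eta> \<and> (\<forall>n. norm (a n) \<le> 2) \<and>
        (\<forall>n. n \<noteq> 0 \<and> \<bar>n\<bar> \<le> int N \<longrightarrow> norm (a n) \<le> \<eta>)"
    and s0: "0 < s0"
    and lip: "\<And>a s. P a \<Longrightarrow> (\<forall>n. norm (a n) \<le> 2) \<Longrightarrow> 0 < s \<Longrightarrow> s < s0 \<Longrightarrow>
        \<exists>b b'. bounded (range b) \<and> bounded (range b') \<and>
          (\<forall>n. a n = b (n + 1) - exp (of_real s) * b n) \<and>
          (\<forall>n. a n = b' (n + 1) - exp (of_real (-s)) * b' n) \<and>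
          norm (b 0 - b' 0) \<le> C * s"
  shows False
proof -
  \<comment> \<open>\<open>s \<le> 1/4\<close> gives \<open>exp (- s) \<ge> 3/4\<close>, and
    \<open>C * s \<le> 1/8\<close> keeps the assumed Lipschitz difference below the jump.\<close>
  define s where "s = min (s0/2) (min (1/4) (1 / (8 * (\<bar>C\<bar> + 1))))"
  have s: "0 < s" "s < s0" "s \<le> 1/4" "C * s \<le> 1/8"
  proof -
    show "0 < s" "s < s0" using s0 by (auto simp: s_def)
    show "s \<le> 1/4" unfolding s_def by linarith
    have "C * s \<le> (\<bar>C\<bar> + 1) * s" using \<open>0 < s\<close> by (intro mult_right_mono) auto
    also have "\<dots> \<le> (\<bar>C\<bar> + 1) * (1 / (8 * (\<bar>C\<bar> + 1)))"
      by (intro mult_left_mono) (auto simp: s_def)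
    also have "\<dots> = 1/8" by (simp add: field_simps)
    finally show "C * s \<le> 1/8" .
  qed
  define q where "q = exp (- s)"
  have q: "0 < q" "q < 1" "q \<ge> 3/4"
    using s exp_ge_add_one_self[of "-s"] by (auto simp: q_def)
  \<comment> \<open>\<open>B\<close> will bound both solutions for inputs of norm at most 2. It
    depends on \<open>s\<close> alone, so \<open>N\<close> can be chosen before the input
    \<open>a\<close>.\<close>
  define B where "B = 2 / (1 - q)"
  have B: "B > 0" using q by (simp add: B_def)
  have "(\<lambda>N. q ^ N * B) \<longlonglongrightarrow> 0"
    using q by (intro tendsto_mult_left_zero LIMSEQ_power_zero) auto
  then have "\<forall>\<^sub>F N in sequentially. q ^ N * B < 1/16"
    by (rule order_tendstoD) auto
  then obtain N where N: "q ^ N * B < 1/16"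
    by (auto simp: eventually_sequentially)
  define \<eta> where "\<eta> = (1 - q) / 16"
  have \<eta>: "0 < \<eta>" "\<eta> \<le> 1/16" "\<eta> / (1 - q) = 1/16" using q by (auto simp: \<eta>_def)
  obtain a where a: "P a" "norm (a 0 - 1) \<le> \<eta>" "\<And>n. norm (a n) \<le> 2"
      "\<And>n. n \<noteq> 0 \<Longrightarrow> \<bar>n\<bar> \<le> int N \<Longrightarrow> norm (a n) \<le> \<eta>"
    using peaks[OF \<eta>(1), of N] by blast
  obtain b b' where b: "bounded (range b)" "\<And>n. a n = b (n + 1) - exp (of_real s) * b n"
     and b': "bounded (range b')" "\<And>n. a n = b' (n + 1) - exp (of_real (-s)) * b' n"
     and bb': "norm (b 0 - b' 0) \<le> C * s"
    using lip[OF a(1) _ s(1,2)] a(3) by blast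
  have q': "exp (complex_of_real (- s)) = of_real q" "exp (complex_of_real s) = of_real (1/q)"
    by (simp_all add: q_def exp_of_real exp_minus field_simps flip: exp_of_real)
  have bB: "norm (b n) \<le> B" for n
  proof -
    have "norm (b n) \<le> 2 / \<bar>norm (exp (complex_of_real s)) - 1\<bar>"
      by (rule bounded_recurrence_bound[OF b(2) a(3) b(1)]) (use s in simp)
    also have "norm (exp (complex_of_real s)) - 1 = (1 - q) / q"
      unfolding q' using q by (simp add: norm_divide field_simps)
    also have "2 / \<bar>(1 - q) / q\<bar> = q * B"
      using q by (simp add: B_def)
    also have "\<dots> \<le> B" using q B by simp
    finally show ?thesis .
  qed
  have bB': "norm (b' n) \<le> B" for n
  proof -
    have "norm (b' n) \<le> 2 / \<bar>norm (exp (complex_of_real (-s))) - 1\<bar>"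
      by (rule bounded_recurrence_bound[OF b'(2) a(3) b'(1)]) (use s in simp)
    then show ?thesis unfolding q' using q by (simp add: B_def)
  qed
  have bstep: "b n = of_real q * (b (n + 1) - a n)" for n
    using b(2)[of n] q by (simp add: q' field_simps)
  \<comment> \<open>For the factor \<open>exp s\<close> the stable direction is backwards, so
    smallness is carried from \<open>N + 1\<close> down to 1, avoiding the mass of \<open>a\<close>
    at 0. For \<open>exp (- s)\<close> it is forwards, from \<open>- N\<close> up to 0, and only
    negative indices of \<open>a\<close> enter.\<close>
  have "norm (b (1 + int 0)) \<le> \<eta> / (1 - q) + q ^ N * norm (b (1 + int N))"
  proof (rule geometric_recursion_bound)
    fix i assume i: "i < N"
    have "norm (b (1 + int i)) \<le> q * (norm (b (1 + int (Suc i))) + norm (a (1 + int i)))"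
      using q bstep[of "1 + int i"] norm_triangle_ineq4[of "b (1 + int i + 1)" "a (1 + int i)"]
      by (simp add: norm_mult add_ac)
    also have "q * norm (a (1 + int i)) \<le> 1 * \<eta>"
      using q i by (intro mult_mono a) auto
    then have "q * (norm (b (1 + int (Suc i))) + norm (a (1 + int i))) \<le> \<eta> + q * norm (b (1 + int (Suc i)))"
      by (simp add: distrib_left)
    finally show "norm (b (1 + int i)) \<le> \<eta> + q * norm (b (1 + int (Suc i)))" .
  qed (use q \<eta> in auto)
  moreover have "q ^ N * norm (b (1 + int N)) \<le> q ^ N * B"
    using q bB by (intro mult_left_mono) auto
  ultimately have b1: "norm (b 1) \<le> 1/8" using \<eta>(3) N by simp
  have "norm (b' (- int 0)) \<le> \<eta> / (1 - q) + q ^ N * norm (b' (- int N))"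
  proof (rule geometric_recursion_bound)
    fix i assume i: "i < N"
    have "b' (- int i) = a (- int (Suc i)) + of_real q * b' (- int (Suc i))"
      using b'(2)[of "- int (Suc i)"] unfolding q' by simp
    then have "norm (b' (- int i)) \<le> norm (a (- int (Suc i))) + q * norm (b' (- int (Suc i)))"
      using q by (metis abs_of_pos norm_mult norm_of_real norm_triangle_ineq)
    also have "norm (a (- int (Suc i))) \<le> \<eta>" using i by (intro a) auto
    finally show "norm (b' (- int i)) \<le> \<eta> + q * norm (b' (- int (Suc i)))" by simp
  qed (use q \<eta> in auto)
  moreover have "q ^ N * norm (b' (- int N)) \<le> q ^ N * B"
    using q bB' by (intro mult_left_mono) auto
  ultimately have b'0: "norm (b' 0) \<le> 1/8" using \<eta>(3) N by simp
  \<comment> \<open>The step across index 0 picks up the mass of \<open>a\<close> and gives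
    \<open>norm (b 0) \<ge> 39/64\<close>, whereas closeness to \<open>b' 0\<close> would allow at
    most 1/4.\<close>
  have "norm (b 0) = q * norm (b 1 - a 0)"
    using bstep[of 0] q by (simp add: norm_mult)
  moreover have "norm (b 1 - a 0) \<ge> 13/16"
    using norm_triangle_ineq2[of "a 0" "b 1"] norm_triangle_ineq2[of 1 "1 - a 0"] a(2) b1 \<eta>
    by (simp add: norm_minus_commute)
  then have "q * norm (b 1 - a 0) \<ge> 3/4 * (13/16)"
    using q by (intro mult_mono) auto
  ultimately have "norm (b 0) \<ge> 39/64" by simp
  then show False
    using bb' s(4) b'0 norm_triangle_ineq2[of "b 0" "b' 0"] by linarith
qed

section \<open>Birkhoff sums\<close>

lemma funpow_mem:
  assumes "\<And>x. x \<in> X \<Longrightarrow> f x \<in> X" "x \<in> X"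
  shows "(f ^^ n) x \<in> X"
  using assms by (induction n) auto

lemma continuous_on_funpow:
  assumes "continuous_on X f" "\<And>x. x \<in> X \<Longrightarrow> f x \<in> X"
  shows "continuous_on X (f ^^ n)"
proof (induction n)
  case (Suc n)
  have "continuous_on X (f \<circ> (f ^^ n))"
    by (rule continuous_on_compose[OF Suc], rule continuous_on_subset[OF assms(1)])
       (use funpow_mem[of X f] assms(2) in blast)
  then show ?case by simp
qed (simp add: id_def)

lemma funpow_left_inverse:
  assumes "\<And>x. x \<in> X \<Longrightarrow> f x \<in> X" "\<And>x. x \<in> X \<Longrightarrow> g (f x) = x" "x \<in> X" "m \<le> i"
  shows "(g ^^ m) ((f ^^ i) x) = (f ^^ (i - m)) x"
  using \<open>m \<le> i\<close>
proof (induction m)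
  case (Suc m)
  then have "i - m = Suc (i - Suc m)" by simp
  then have "(f ^^ (i - m)) x = f ((f ^^ (i - Suc m)) x)" by simp
  with Suc show ?case using assms(2) funpow_mem[of X f x, OF assms(1) assms(3)] by simp
qed simp

lemma birkhoff_sum_add:
  fixes u :: "'x \<Rightarrow> 'b::comm_monoid_add"
  shows "(\<Sum>i<m+n. u ((f ^^ i) x)) = (\<Sum>i<m. u ((f ^^ i) x)) + (\<Sum>i<n. u ((f ^^ i) ((f ^^ m) x)))"
proof (induction n)
  case (Suc n)
  have "(f ^^ (m + n)) x = (f ^^ n) ((f ^^ m) x)"
    by (metis add.commute comp_apply funpow_add)
  with Suc show ?case by (simp add: add.assoc)
qed simp

text \<open>A suitable orbit position nearly maximises \<open>i \<mapsto> S i - L * i\<close>, where \<open>S\<close> are the Birkhoff sums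
  and \<open>L\<close> their maximal growth rate: the penalty \<open>\<kappa> * \<bar>i - n/2\<bar>\<close> keeps the maximum away from the
  ends of a long orbit segment, and compactness removes the penalty.\<close>

lemma two_sided_birkhoff_maximum:
  fixes X :: "'x::topological_space set" and u :: "'x \<Rightarrow> real"
  assumes X: "compact X" "closed X" "X \<noteq> {}"
    and \<phi>: "continuous_on X \<phi>" "\<And>x. x \<in> X \<Longrightarrow> \<phi> x \<in> X"
    and \<psi>: "continuous_on X \<psi>" "\<And>x. x \<in> X \<Longrightarrow> \<psi> x \<in> X"
    and inv: "\<And>x. x \<in> X \<Longrightarrow> \<psi> (\<phi> x) = x"
    and u: "continuous_on X u"
  obtains t L where "t \<in> X"
    "\<And>n. (\<Sum>i<n. u ((\<phi> ^^ i) t)) \<le> real n * L"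
    "\<And>n. real n * L \<le> (\<Sum>i<n. u ((\<phi> ^^ i) ((\<psi> ^^ n) t)))"
proof -
  define S where "S n x = (\<Sum>i<n. u ((\<phi> ^^ i) x))" for n x
  have \<phi>n: "(\<phi> ^^ n) x \<in> X" if "x \<in> X" for n x using funpow_mem \<phi>(2) that by metis
  have \<psi>n: "(\<psi> ^^ n) x \<in> X" if "x \<in> X" for n x using funpow_mem \<psi>(2) that by metis
  have Sadd: "S (m + n) x = S m x + S n ((\<phi> ^^ m) x)" for m n x
    unfolding S_def by (rule birkhoff_sum_add)
  have contS: "continuous_on X (S n)" for n
    unfolding S_def
    by (intro continuous_intros continuous_on_compose2[OF u continuous_on_funpow[OF \<phi>]]) (use \<phi>n in auto)
  have contS': "continuous_on X (\<lambda>x. S n ((\<psi> ^^ n) x))" for n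
    by (rule continuous_on_compose2[OF contS continuous_on_funpow[OF \<psi>]]) (use \<psi>n in auto)
  obtain x1 where x1: "x1 \<in> X" using X by blast
  have "compact (u ` X)" by (intro compact_continuous_image u X)
  then obtain B where B: "\<And>x. x \<in> X \<Longrightarrow> \<bar>u x\<bar> \<le> B"
    using compact_imp_bounded bounded_iff by (metis image_eqI real_norm_def)
  have SB: "\<bar>S n x\<bar> \<le> real n * B" if "x \<in> X" for n x
  proof -
    have "\<bar>S n x\<bar> \<le> (\<Sum>i<n. \<bar>u ((\<phi> ^^ i) x)\<bar>)" unfolding S_def by (rule sum_abs)
    also have "\<dots> \<le> (\<Sum>i<n. B)" by (intro sum_mono B \<phi>n that)
    finally show ?thesis by simp
  qed
  \<comment> \<open>The rates dominating all Birkhoff sums up to a constant. Their infimum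
    \<open>L\<close> is the maximal growth rate; any smaller rate is exceeded by arbitrarily large
    amounts.\<close>
  define \<Lambda> where "\<Lambda> = {l. \<exists>C. \<forall>n. \<forall>x\<in>X. S n x \<le> C + l * real n}"
  have "B \<in> \<Lambda>"
    unfolding \<Lambda>_def using SB by (force intro!: exI[of _ 0] simp: mult.commute abs_le_iff)
  have low: "- B \<le> l" if l: "l \<in> \<Lambda>" for l
  proof (rule ccontr)
    assume "\<not> ?thesis"
    then have pos: "- B - l > 0" by simp
    obtain C where C: "\<And>n x. x \<in> X \<Longrightarrow> S n x \<le> C + l * real n" using l by (auto simp: \<Lambda>_def)
    obtain n :: nat where n: "C < real n * (- B - l)" using reals_Archimedean3[OF pos] by blast
    have "- (real n * B) \<le> C + l * real n" using C[OF x1, of n] SB[OF x1, of n] by (simp add: abs_le_iff)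
    with n show False by (simp add: algebra_simps)
  qed
  define L where "L = Inf \<Lambda>"
  have bdd: "bdd_below \<Lambda>" using low by (auto simp: bdd_below_def)
  have upper: "\<exists>C\<ge>0. \<forall>n. \<forall>x\<in>X. S n x \<le> C + (L + \<epsilon>) * real n" if "\<epsilon> > 0" for \<epsilon>
  proof -
    have "Inf \<Lambda> < L + \<epsilon>" using that by (simp add: L_def)
    then obtain l where l: "l \<in> \<Lambda>" "l < L + \<epsilon>"
      using cInf_less_iff[OF _ bdd] \<open>B \<in> \<Lambda>\<close> by blast
    then obtain C where C: "\<And>n x. x \<in> X \<Longrightarrow> S n x \<le> C + l * real n" by (auto simp: \<Lambda>_def)
    have "S n x \<le> \<bar>C\<bar> + (L + \<epsilon>) * real n" if "x \<in> X" for n x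
    proof -
      have "l * real n \<le> (L + \<epsilon>) * real n" using l by (intro mult_right_mono) auto
      then show ?thesis using C[OF that, of n] by linarith
    qed
    then show ?thesis by (intro exI[of _ "\<bar>C\<bar>"]) auto
  qed
  have lower: "\<exists>n. \<exists>x\<in>X. S n x > C + (L - \<epsilon>) * real n" if "\<epsilon> > 0" for \<epsilon> C
  proof (rule ccontr)
    assume "\<not> ?thesis"
    then have "L - \<epsilon> \<in> \<Lambda>" unfolding \<Lambda>_def by (auto simp: not_less)
    then have "L \<le> L - \<epsilon>" unfolding L_def by (intro cInf_lower bdd)
    with that show False by simp
  qed
  have window: "\<exists>t\<in>X. \<forall>m\<le>N. S m t \<le> real m * (L + \<kappa>) \<and> real m * (L - \<kappa>) \<le> S m ((\<psi> ^^ m) t)"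
    if \<kappa>: "\<kappa> > 0" for \<kappa> N
  proof -
    \<comment> \<open>The value 1/24 makes the accumulated error \<open>3 * \<epsilon> * n\<close>
      equal to \<open>\<kappa> * n / 8\<close>.\<close>
    define \<epsilon> where "\<epsilon> = \<kappa> / 24"
    have \<epsilon>: "\<epsilon> > 0" using \<kappa> by (simp add: \<epsilon>_def)
    obtain C where C: "C \<ge> 0" "\<And>n x. x \<in> X \<Longrightarrow> S n x \<le> C + (L + \<epsilon>) * real n"
      using upper[OF \<epsilon>] by blast
    define p where "p = C / \<kappa>"
    \<comment> \<open>A length \<open>n > n0\<close> makes \<open>p + 1/2\<close>,
      \<open>n / 8\<close> and \<open>N\<close> add up to less than \<open>n / 2\<close>. The
      constant \<open>D\<close> forces such a length, since on shorter segments the growth bound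
      excludes a sum above \<open>D + (L - \<epsilon>) * n\<close>.\<close>
    define n0 where "n0 = max (4 * real N) (4 + 8 * p)"
    define D where "D = C + 2 * \<epsilon> * n0"
    obtain n x where x: "x \<in> X" and n: "S n x > D + (L - \<epsilon>) * real n"
      using lower[OF \<epsilon>] by blast
    have "2 * \<epsilon> * n0 < 2 * \<epsilon> * real n"
      using n C(2)[OF x, of n] by (simp add: D_def algebra_simps)
    then have n0: "n0 < real n" using \<epsilon> by simp
    have n0_pos: "n0 \<ge> 0" by (simp add: n0_def)
    have DC: "D \<ge> C" using \<epsilon> n0_pos by (simp add: D_def)
    define Q where "Q i = S i x - L * real i - \<kappa> * \<bar>real i - real n / 2\<bar>" for i
    have "Max (Q ` {..n}) \<in> Q ` {..n}" by (intro Max_in) auto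
    then obtain i0 where "i0 \<le> n" and Qmax: "Q i0 = Max (Q ` {..n})" by force
    then have i0: "i0 \<le> n" "\<And>i. i \<le> n \<Longrightarrow> Q i \<le> Q i0" by auto
    \<comment> \<open>The midpoint competes for the maximum: its penalty is at most
      \<open>\<kappa> / 2\<close>, and its Birkhoff sum is bounded below because the second half of
      the segment obeys the growth bound.\<close>
    define c where "c = n div 2"
    have c: "c \<le> n" "\<bar>real c - real n / 2\<bar> \<le> 1/2" unfolding c_def by linarith+
    have "S n x = S c x + S (n - c) ((\<phi> ^^ c) x)"
      using Sadd[of c "n - c" x] c by simp
    then have "S n x \<le> S c x + (C + (L + \<epsilon>) * real (n - c))"
      using C(2)[OF \<phi>n[OF x], of "n - c" c] by simp
    then have "S c x - L * real c \<ge> D - C - 2 * \<epsilon> * real n + \<epsilon> * real c"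
      using n c by (simp add: algebra_simps of_nat_diff)
    then have "S c x - L * real c \<ge> - (2 * \<epsilon> * real n)"
      using DC \<epsilon> mult_nonneg_nonneg[of \<epsilon> "real c"] by linarith
    moreover have "\<kappa> * \<bar>real c - real n / 2\<bar> \<le> \<kappa> * (1/2)"
      using \<kappa> c by (intro mult_left_mono) auto
    ultimately have Qc: "Q c \<ge> - (2 * \<epsilon> * real n) - \<kappa> / 2" unfolding Q_def by linarith
    have "\<epsilon> * real i0 \<le> \<epsilon> * real n" using \<epsilon> i0 by (intro mult_left_mono) auto
    then have "Q i0 \<le> C + \<epsilon> * real n - \<kappa> * \<bar>real i0 - real n / 2\<bar>"
      using C(2)[OF x, of i0] by (simp add: Q_def algebra_simps)
    then have "\<kappa> * \<bar>real i0 - real n / 2\<bar> \<le> C + 3 * (\<epsilon> * real n) + \<kappa> / 2"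
      using Qc i0(2)[OF c(1)] by (simp add: algebra_simps)
    also have "\<dots> = \<kappa> * (p + real n / 8 + 1/2)"
      using \<kappa> by (simp add: p_def \<epsilon>_def field_simps)
    finally have "\<bar>real i0 - real n / 2\<bar> \<le> p + real n / 8 + 1/2"
      using \<kappa> by simp
    moreover have "4 + 8 * p < real n" "4 * real N < real n"
      using n0 unfolding n0_def by linarith+
    ultimately have mid: "\<bar>real i0 - real n / 2\<bar> + real N \<le> real n / 2" by linarith
    have "real N \<le> real i0" using mid by linarith
    moreover have "real i0 + real N \<le> real n" using mid by linarith
    ultimately have N: "N \<le> i0" "i0 + N \<le> n" by auto
    show ?thesis
    proof (intro bexI[of _ "(\<phi> ^^ i0) x"] allI impI conjI)
      show "(\<phi> ^^ i0) x \<in> X" by (rule \<phi>n[OF x])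
      fix m assume m: "m \<le> N"
      \<comment> \<open>Comparison with later indices bounds forward sums from above, comparison
        with earlier ones bounds backward sums from below; the penalty changes by at most
        \<open>\<kappa> * m\<close>.\<close>
      have "Q (i0 + m) \<le> Q i0" using N m by (intro i0) simp
      then have "S m ((\<phi> ^^ i0) x) \<le> L * real m
          + \<kappa> * (\<bar>real (i0 + m) - real n / 2\<bar> - \<bar>real i0 - real n / 2\<bar>)"
        by (simp add: Q_def Sadd algebra_simps)
      also have "\<dots> \<le> L * real m + \<kappa> * real m"
        using \<kappa> by (intro add_left_mono mult_left_mono) auto
      finally show "S m ((\<phi> ^^ i0) x) \<le> real m * (L + \<kappa>)" by (simp add: algebra_simps)
      have "Q (i0 - m) \<le> Q i0" using i0 by (intro i0) simp
      moreover have "S i0 x = S (i0 - m) x + S m ((\<phi> ^^ (i0 - m)) x)"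
        using Sadd[of "i0 - m" m x] N m by simp
      ultimately have "S m ((\<phi> ^^ (i0 - m)) x) \<ge> L * real m
          - \<kappa> * (\<bar>real (i0 - m) - real n / 2\<bar> - \<bar>real i0 - real n / 2\<bar>)"
        using N m by (simp add: Q_def of_nat_diff algebra_simps)
      moreover have "\<kappa> * (\<bar>real (i0 - m) - real n / 2\<bar> - \<bar>real i0 - real n / 2\<bar>) \<le> \<kappa> * real m"
        using \<kappa> N m by (intro mult_left_mono) (auto simp: of_nat_diff)
      moreover have "(\<psi> ^^ m) ((\<phi> ^^ i0) x) = (\<phi> ^^ (i0 - m)) x"
        by (rule funpow_left_inverse[of X]) (use \<phi> inv x N m in auto)
      ultimately show "real m * (L - \<kappa>) \<le> S m ((\<psi> ^^ m) ((\<phi> ^^ i0) x))"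
        by (simp add: algebra_simps)
    qed
  qed
  \<comment> \<open>Points good for windows up to length \<open>k\<close> with slack
    \<open>1 / Suc k\<close>. Both requirements tighten with \<open>k\<close>, so a point common to
    all these closed sets has no slack on any window.\<close>
  define K where "K k = {t \<in> X. \<forall>m\<le>k. S m t \<le> real m * (L + 1 / Suc k) \<and>
      real m * (L - 1 / Suc k) \<le> S m ((\<psi> ^^ m) t)}" for k
  have K_eq: "K k = X \<inter> (\<Inter>m\<in>{..k}. {t \<in> X. S m t \<le> real m * (L + 1 / Suc k)}
      \<inter> {t \<in> X. real m * (L - 1 / Suc k) \<le> S m ((\<psi> ^^ m) t)})" for k
    unfolding K_def by auto
  have closedK: "closed (K k)" for k
    unfolding K_eq
    by (intro closed_Int X(2) closed_INT ballI
        continuous_on_closed_Collect_le continuous_on_const contS contS' X(2))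
  have decK: "K k' \<subseteq> K k" if "k \<le> k'" for k k'
  proof -
    have 1: "1 / real (Suc k') \<le> 1 / real (Suc k)" using that by (simp add: field_simps)
    have "real m * (L + 1 / Suc k') \<le> real m * (L + 1 / Suc k)"
         "real m * (L - 1 / Suc k) \<le> real m * (L - 1 / Suc k')" for m
      using 1 by (intro mult_left_mono; simp)+
    note mono = this
    show ?thesis
    proof
      fix t assume t: "t \<in> K k'"
      then have all: "\<forall>m\<le>k'. S m t \<le> real m * (L + 1 / Suc k') \<and> real m * (L - 1 / Suc k') \<le> S m ((\<psi> ^^ m) t)"
        unfolding K_def by blast
      have "S m t \<le> real m * (L + 1 / Suc k) \<and> real m * (L - 1 / Suc k) \<le> S m ((\<psi> ^^ m) t)"
        if "m \<le> k" for m
      proof -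
        have "S m t \<le> real m * (L + 1 / Suc k') \<and> real m * (L - 1 / Suc k') \<le> S m ((\<psi> ^^ m) t)"
          by (rule all[rule_format]) (use that \<open>k \<le> k'\<close> in linarith)
        then show ?thesis using mono[of m] by linarith
      qed
      moreover have "t \<in> X" using t by (simp add: K_def)
      ultimately show "t \<in> K k" by (simp add: K_def)
    qed
  qed
  have "X \<inter> (\<Inter>k. K k) \<noteq> {}"
  proof (rule compact_imp_fip_image[OF X(1) closedK])
    fix I :: "nat set" assume "finite I"
    then obtain k where k: "\<forall>i\<in>I. i \<le> k" unfolding finite_nat_set_iff_bounded_le by blast
    have "0 < 1 / real (Suc k)" by simp
    from window[OF this, of k] obtain t where "t \<in> K k" unfolding K_def by blast
    moreover have "K k \<subseteq> X" unfolding K_def by blast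
    ultimately show "X \<inter> (\<Inter>i\<in>I. K i) \<noteq> {}" using decK k by blast
  qed
  then obtain t where t: "t \<in> X" "\<And>k. t \<in> K k" by blast
  have lim: "(\<lambda>k. real m * (L + 1 / Suc k)) \<longlonglongrightarrow> real m * (L + 0)"
            "(\<lambda>k. real m * (L - 1 / Suc k)) \<longlonglongrightarrow> real m * (L - 0)" for m
    by (intro tendsto_intros lim_1_over_n[THEN LIMSEQ_Suc])+
  show ?thesis
  proof (rule that[OF t(1)])
    fix n
    have "S n t \<le> real n * (L + 0)"
      by (rule Lim_bounded2[OF lim(1)[of n], where N = n]) (use t(2) in \<open>auto simp: K_def\<close>)
    then show "(\<Sum>i<n. u ((\<phi> ^^ i) t)) \<le> real n * L" by (simp add: S_def)
    have "real n * (L - 0) \<le> S n ((\<psi> ^^ n) t)"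
      by (rule Lim_bounded[OF lim(2)[of n], where M = n]) (use t(2) in \<open>auto simp: K_def\<close>)
    then show "real n * L \<le> (\<Sum>i<n. u ((\<phi> ^^ i) ((\<psi> ^^ n) t)))" by (simp add: S_def)
  qed
qed

section \<open>Characters and the Shilov boundary\<close>

lemma cscale_of_real: "cscale j (of_real r) x = r *\<^sub>R x"
  by (simp add: cscale_def)

lemma cscale_one [simp]: "cscale j 1 x = x"
  by (simp add: cscale_def)

lemma norm_cscale: "complex_banach_alg j \<Longrightarrow> norm (cscale j c x) = cmod c * norm x"
  by (simp add: complex_banach_alg_def)

lemma character_one: "m \<in> characters j \<Longrightarrow> m 1 = 1"
  and character_add: "m \<in> characters j \<Longrightarrow> m (x + y) = m x + m y"
  and character_mult: "m \<in> characters j \<Longrightarrow> m (x * y) = m x * m y"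
  and character_cscale: "m \<in> characters j \<Longrightarrow> m (cscale j c x) = c * m x"
  by (simp_all add: characters_def)

lemma character_power: "m \<in> characters j \<Longrightarrow> m (x ^ n) = m x ^ n"
  by (induction n) (simp_all add: character_one character_mult)

lemma character_scaleR: "m \<in> characters j \<Longrightarrow> m (r *\<^sub>R x) = of_real r * m x"
  using character_cscale[of m j "of_real r" x] by (simp add: cscale_of_real)

lemma character_diff: "m \<in> characters j \<Longrightarrow> m (x - y) = m x - m y"
  using character_add[of m j x "(-1) *\<^sub>R y"] character_scaleR[of m j "-1" y] by simp

lemma character_zero: "m \<in> characters j \<Longrightarrow> m 0 = 0"
  using character_scaleR[of m j 0 0] by simp

text \<open>If \<open>norm f\<close> were below \<open>cmod (m f)\<close>, then
  \<open>x = f / m f\<close> would have norm below 1 and character value 1; its geometric series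
  satisfies \<open>y = 1 + x * y\<close>, and applying \<open>m\<close> gives
  \<open>m y = 1 + m y\<close>.\<close>

lemma character_bound:
  assumes j: "complex_banach_alg j" and m: "m \<in> characters j"
  shows "cmod (m f) \<le> norm f"
proof (rule ccontr)
  assume "\<not> ?thesis"
  then have less: "norm f < cmod (m f)" by simp
  then have nz: "m f \<noteq> 0" by auto
  define x where "x = cscale j (1 / m f) f"
  have "norm x < 1" using less nz by (simp add: x_def norm_cscale[OF j] norm_divide)
  then have summ: "summable (\<lambda>n. x ^ n)" by (rule complete_algebra_summable_geometric)
  define y where "y = (\<Sum>n. x ^ n)"
  have "y = 1 + x * y"
    using suminf_split_head[OF summ] suminf_mult[OF summ, of x] by (simp add: y_def)
  moreover have "m x = 1" using nz m by (simp add: x_def character_cscale)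
  ultimately have "m y = 1 + m y"
    by (metis character_add character_mult character_one m mult_1)
  then show False by simp
qed

lemma character_bounded_linear:
  assumes "complex_banach_alg j" "m \<in> characters j"
  shows "bounded_linear m"
  by (rule bounded_linear_intro[where K = 1])
     (use assms in \<open>simp_all add: character_add character_scaleR scaleR_conv_of_real[where 'a = complex] character_bound\<close>)

lemma continuous_on_eval: "continuous_on X (\<lambda>m. m f :: complex)"
  by (rule continuous_on_subset[OF continuous_on_product_coordinates]) simp

lemma closed_characters: "closed (characters j)"
  unfolding characters_def
  by (intro closed_Collect_conj closed_Collect_all closed_Collect_eq continuous_intros continuous_on_eval)

text \<open>The Banach-Alaoglu argument: by Tychonoff the product of the discs of radius
  \<open>norm f\<close> is compact, and it contains the closed set of characters.\<close>

lemma compact_characters: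
  assumes j: "complex_banach_alg j"
  shows "compact (characters j)"
proof -
  have "compactin (product_topology (\<lambda>_. euclidean) UNIV) (PiE UNIV (\<lambda>f::'a. cball (0::complex) (norm f)))"
    by (simp add: compactin_PiE)
  then have "compact (PiE UNIV (\<lambda>f::'a. cball (0::complex) (norm f)))"
    by (simp add: euclidean_product_topology)
  moreover have "characters j \<subseteq> PiE UNIV (\<lambda>f::'a. cball (0::complex) (norm f))"
    using character_bound[OF j] by auto
  ultimately show ?thesis using closed_characters by (metis compact_Int_closed inf.absorb2)
qed

section \<open>Minimal closed boundaries\<close>

lemma is_boundary_characters:
  assumes j: "complex_banach_alg j" and ne: "characters j \<noteq> {}"
  shows "is_boundary j (characters j)"
proof -
  have "\<exists>m\<in>characters j. \<forall>m'\<in>characters j. cmod (m' f) \<le> cmod (m f)" for f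
    by (rule continuous_attains_sup[OF compact_characters[OF j] ne])
       (intro continuous_intros continuous_on_eval)
  then show ?thesis by (simp add: is_boundary_def)
qed

text \<open>Zorn's lemma is applied to complements, so that a chain is bounded by its union. The
  intersection of a chain of closed boundaries is again a boundary by compactness of the set where a
  given \<open>f\<close> attains its maximum modulus.\<close>

lemma minimal_closed_boundary:
  assumes j: "complex_banach_alg j" and ne: "characters j \<noteq> {}"
  obtains B0 where "closed B0" "is_boundary j B0"
    "\<And>B. closed B \<Longrightarrow> is_boundary j B \<Longrightarrow> B \<subseteq> B0 \<Longrightarrow> B = B0"
proof -
  let ?A = "{C. closed (- C) \<and> is_boundary j (- C)}"
  have "\<exists>M\<in>?A. \<forall>Y\<in>?A. M \<subseteq> Y \<longrightarrow> Y = M"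
  proof (rule subset_Zorn_nonempty)
    have "- characters j \<in> ?A" using closed_characters is_boundary_characters[OF assms] by simp
    then show "?A \<noteq> {}" by blast
    fix \<C> assume \<C>: "\<C> \<noteq> {}" "subset.chain ?A \<C>"
    then have mem: "closed (- C)" "is_boundary j (- C)" if "C \<in> \<C>" for C
      using that unfolding subset.chain_def by auto
    have "\<exists>m\<in>- \<Union>\<C>. \<forall>m'\<in>characters j. cmod (m' f) \<le> cmod (m f)" for f
    proof -
      obtain m0 where m0: "m0 \<in> characters j" "\<And>m'. m' \<in> characters j \<Longrightarrow> cmod (m' f) \<le> cmod (m0 f)"
        using is_boundary_characters[OF assms] unfolding is_boundary_def by blast
      define K where "K = {m \<in> characters j. cmod (m0 f) \<le> cmod (m f)}"
      have "closed K"
        unfolding K_def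
        by (intro continuous_on_closed_Collect_le closed_characters continuous_intros continuous_on_eval)
      moreover have "K \<subseteq> characters j" by (auto simp: K_def)
      ultimately have "compact K" using compact_characters[OF j] by (metis compact_Int_closed inf.absorb2)
      then have "K \<inter> (\<Inter>C\<in>\<C>. - C) \<noteq> {}"
      proof (rule compact_imp_fip_image)
        fix F assume F: "finite F" "F \<subseteq> \<C>"
        show "K \<inter> (\<Inter>C\<in>F. - C) \<noteq> {}"
        proof (cases "F = {}")
          case False
          \<comment> \<open>A finite nonempty part of a chain contains its union, so the
            corresponding intersection is itself a boundary and meets \<open>K\<close>.\<close>
          then have "\<Union>F \<in> F"
            using F \<C>(2) by (intro Union_in_chain[of F ?A]) (simp_all add: subset_chain_def subset_iff)
          then have "is_boundary j (- \<Union>F)" using mem(2) F by blast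
          then obtain m where m: "m \<in> - \<Union>F" "\<forall>m'\<in>characters j. cmod (m' f) \<le> cmod (m f)"
              "- \<Union>F \<subseteq> characters j"
            unfolding is_boundary_def by meson
          have "m \<in> K" using subsetD[OF m(3) m(1)] bspec[OF m(2) m0(1)] by (simp add: K_def)
          with m(1) show ?thesis by blast
        qed (use m0 in \<open>auto simp: K_def\<close>)
      qed (use mem in auto)
      then obtain m where m: "m \<in> K" "m \<in> - \<Union>\<C>" by blast
      show ?thesis
      proof (intro bexI[OF _ m(2)] ballI)
        fix m' assume "m' \<in> characters j"
        then have "cmod (m' f) \<le> cmod (m0 f)" by (rule m0(2))
        also have "\<dots> \<le> cmod (m f)" using m(1) by (simp add: K_def)
        finally show "cmod (m' f) \<le> cmod (m f)" .
      qed
    qed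
    moreover have "- \<Union>\<C> \<subseteq> characters j"
      using \<C>(1) mem(2) unfolding is_boundary_def by blast
    moreover have "closed (- \<Union>\<C>)"
      using mem(1) by (auto simp: closed_def)
    ultimately show "\<Union>\<C> \<in> ?A" by (simp add: is_boundary_def)
  qed
  then obtain M where M: "closed (- M)" "is_boundary j (- M)"
     "\<And>Y. closed (- Y) \<Longrightarrow> is_boundary j (- Y) \<Longrightarrow> M \<subseteq> Y \<Longrightarrow> Y = M" by auto
  show ?thesis
  proof (rule that[OF M(1,2)])
    fix B assume "closed B" "is_boundary j B" "B \<subseteq> - M"
    then show "B = - M" using M(3)[of "- B"] by auto
  qed
qed

lemma open_fun_basic_neighbourhood:
  fixes m :: "'a \<Rightarrow> complex"
  assumes "open V" "m \<in> V"
  obtains F e where "finite F" "e > 0" "{m'. \<forall>f\<in>F. cmod (m' f - m f) < e} \<subseteq> V"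
proof -
  have "openin (product_topology (\<lambda>_. euclidean) UNIV) V"
    using assms(1) by (simp add: open_fun_def)
  then obtain W where W: "finite {i. W i \<noteq> UNIV}" "\<And>i. open (W i)" "m \<in> PiE UNIV W" "PiE UNIV W \<subseteq> V"
    using assms(2) unfolding openin_product_topology_alt by force
  have "\<exists>e>0. ball (m i) e \<subseteq> W i" for i
    using W(2,3) open_contains_ball by (metis PiE_mem UNIV_I)
  then obtain d where d: "\<And>i. d i > 0" "\<And>i. ball (m i) (d i) \<subseteq> W i" by metis
  define F where "F = {i. W i \<noteq> UNIV}"
  define e where "e = Min (insert 1 (d ` F))"
  have F: "finite F" using W by (simp add: F_def)
  have e: "e > 0" "\<And>i. i \<in> F \<Longrightarrow> e \<le> d i"
    using F d by (auto simp: e_def)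
  have "{m'. \<forall>f\<in>F. cmod (m' f - m f) < e} \<subseteq> V"
  proof
    fix m' assume m': "m' \<in> {m'. \<forall>f\<in>F. cmod (m' f - m f) < e}"
    have "m' i \<in> W i" for i
    proof (cases "i \<in> F")
      case True
      then have "m' i \<in> ball (m i) (d i)" using m' e(2)[OF True] by (auto simp: dist_norm norm_minus_commute)
      then show ?thesis using d by blast
    qed (simp add: F_def)
    then show "m' \<in> V" using W(4) by auto
  qed
  with F e(1) show ?thesis using that by blast
qed

text \<open>If \<open>m\<close> in \<open>B0\<close> had a basic neighbourhood \<open>V\<close>
  missing \<open>B\<close>, minimality would give an \<open>f\<close> whose maximum modulus is not
  reached on \<open>B0 - V\<close>. A high power of \<open>f / r\<close> times
  \<open>g - m g\<close> is then small on \<open>B0\<close>, hence at all characters; at a point of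
  \<open>B\<close> where that power has modulus at least 1 this forces the point into
  \<open>V\<close>.\<close>

lemma minimal_boundary_subset_boundary:
  assumes j: "complex_banach_alg j"
    and B0: "closed B0" "is_boundary j B0"
    and min: "\<And>B. closed B \<Longrightarrow> is_boundary j B \<Longrightarrow> B \<subseteq> B0 \<Longrightarrow> B = B0"
    and B: "closed B" "is_boundary j B"
  shows "B0 \<subseteq> B"
proof
  fix m assume m: "m \<in> B0"
  have B0c: "B0 \<subseteq> characters j" and Bc: "B \<subseteq> characters j" using B0 B by (auto simp: is_boundary_def)
  then have mc: "m \<in> characters j" using m by blast
  show "m \<in> B"
  proof (rule ccontr)
    assume "m \<notin> B"
    then obtain F e where F: "finite F" and e: "e > 0" "{m'. \<forall>f\<in>F. cmod (m' f - m f) < e} \<subseteq> - B"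
      using open_fun_basic_neighbourhood[of "- B" m] B(1) by (auto simp: open_Compl)
    define V where "V = {m'. \<forall>f\<in>F. cmod (m' f - m f) < e}"
    have V_eq: "V = (\<Inter>f\<in>F. {m'. cmod (m' f - m f) < e})" by (auto simp: V_def)
    have "open V"
      unfolding V_eq by (intro open_INT F ballI open_Collect_less continuous_intros continuous_on_eval)
    then have "closed (B0 - V)" using B0 by blast
    moreover have "m \<in> V" using e by (simp add: V_def)
    then have "B0 - V \<noteq> B0" using m by blast
    ultimately have "\<not> is_boundary j (B0 - V)" using min by blast
    have "\<exists>f r q. 0 < r \<and> 0 \<le> q \<and> q < 1 \<and> (\<forall>m\<in>characters j. cmod (m f) \<le> r) \<and>
        (\<exists>m\<in>characters j. cmod (m f) = r) \<and> (\<forall>m\<in>B0 - V. cmod (m f) \<le> q * r)"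
    proof (cases "B0 - V = {}")
      \<comment> \<open>If \<open>V\<close> covers \<open>B0\<close>, the constant 1 with
        \<open>q = 0\<close> serves, the last condition being vacuous.\<close>
      case True
      then show ?thesis
        using mc by (intro exI[of _ 1] exI[of _ 0] conjI) (auto simp: character_one)
    next
      case False
      obtain f where f: "\<And>m. m \<in> B0 - V \<Longrightarrow> \<exists>m'\<in>characters j. cmod (m f) < cmod (m' f)"
        using B0c \<open>\<not> is_boundary j (B0 - V)\<close> unfolding is_boundary_def by (fastforce simp: not_le)
      obtain m1 where m1: "m1 \<in> B0" "\<And>m'. m' \<in> characters j \<Longrightarrow> cmod (m' f) \<le> cmod (m1 f)"
        using B0 unfolding is_boundary_def by blast
      have lt: "cmod (m f) < cmod (m1 f)" if "m \<in> B0 - V" for m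
        using f[OF that] m1(2) by (metis order_less_le_trans)
      have "compact (B0 - V)"
        using \<open>closed (B0 - V)\<close> compact_characters[OF j] B0c
        by (metis Diff_subset compact_Int_closed inf.absorb2 order_trans)
      then obtain m2 where m2: "m2 \<in> B0 - V" "\<And>m. m \<in> B0 - V \<Longrightarrow> cmod (m f) \<le> cmod (m2 f)"
        using continuous_attains_sup[OF _ False, of "\<lambda>m. cmod (m f)"]
        by (metis continuous_on_eval continuous_on_norm)
      have r: "cmod (m1 f) > 0" using lt[OF m2(1)] norm_ge_zero[of "m2 f"] by linarith
      show ?thesis
      proof (intro exI conjI ballI)
        show "0 < cmod (m1 f)" by (rule r)
        show "0 \<le> cmod (m2 f) / cmod (m1 f)" by simp
        show "cmod (m2 f) / cmod (m1 f) < 1" using lt[OF m2(1)] r by simp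
        show "\<exists>m\<in>characters j. cmod (m f) = cmod (m1 f)" using m1 B0c by blast
        show "cmod (m f) \<le> cmod (m1 f)" if "m \<in> characters j" for m using m1 that by simp
        show "cmod (m f) \<le> cmod (m2 f) / cmod (m1 f) * cmod (m1 f)" if "m \<in> B0 - V" for m
          using m2(2)[OF that] r by simp
      qed
    qed
    then obtain f r q m1 where r: "0 < r" and q: "0 \<le> q" "q < 1"
      and f: "\<And>m. m \<in> characters j \<Longrightarrow> cmod (m f) \<le> r" "\<And>m. m \<in> B0 - V \<Longrightarrow> cmod (m f) \<le> q * r"
      and m1: "m1 \<in> characters j" "cmod (m1 f) = r" by blast
    define k where "k g = g - cscale j (m g) 1" for g
    have mk: "m' (k g) = m' g - m g" if "m' \<in> characters j" for m' g
      using that by (simp add: k_def character_diff character_cscale character_one)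
    define D where "D = Max (insert 1 ((\<lambda>g. norm (k g)) ` F))"
    have D: "D > 0" "\<And>g. g \<in> F \<Longrightarrow> norm (k g) \<le> D"
      using F by (auto simp: D_def less_le_trans[OF zero_less_one])
    have "(\<lambda>N. q ^ N * D) \<longlonglongrightarrow> 0"
      using q by (intro tendsto_mult_left_zero LIMSEQ_power_zero) auto
    then have "\<forall>\<^sub>F N in sequentially. q ^ N * D < e"
      by (rule order_tendstoD) (rule e)
    then obtain N where N: "q ^ N * D < e"
      by (auto simp: eventually_sequentially)
    define h where "h = ((1/r) *\<^sub>R f) ^ N"
    have mh: "cmod (m' h) = (cmod (m' f) / r) ^ N" if "m' \<in> characters j" for m'
      using that r by (simp add: h_def character_power character_scaleR norm_power norm_mult norm_divide power_divide)
    \<comment> \<open>Inside \<open>V\<close> the factor \<open>k g\<close> is small and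
      \<open>h\<close> is at most 1 in modulus; outside \<open>V\<close> the power \<open>h\<close>
      beats the bound \<open>D\<close> on \<open>k g\<close>.\<close>
    have small0: "cmod (m' (h * k g)) < e" if m': "m' \<in> B0" and m'c: "m' \<in> characters j" and g: "g \<in> F" for m' g
    proof (cases "m' \<in> V")
      case True
      have "cmod (m' h) \<le> 1"
        unfolding mh[OF m'c] using f(1)[OF m'c] r by (intro power_le_one) auto
      then have "cmod (m' h) * cmod (m' (k g)) \<le> 1 * cmod (m' (k g))" by (intro mult_right_mono) auto
      also have "\<dots> < e" using True g by (simp add: V_def mk[OF m'c])
      finally show ?thesis by (simp add: character_mult[OF m'c] norm_mult)
    next
      case False
      have "cmod (m' h) \<le> q ^ N"
        unfolding mh[OF m'c] using f(2)[of m'] m' False r by (intro power_mono) (auto simp: pos_divide_le_eq)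
      moreover have "cmod (m' (k g)) \<le> D"
        using character_bound[OF j m'c, of "k g"] D(2)[OF g] by linarith
      ultimately have "cmod (m' h) * cmod (m' (k g)) \<le> q ^ N * D"
        using q by (intro mult_mono) auto
      then show ?thesis using N by (simp add: character_mult[OF m'c] norm_mult)
    qed
    have small: "cmod (m' (h * k g)) < e" if m': "m' \<in> characters j" and g: "g \<in> F" for m' g
    proof -
      obtain m'' where "m'' \<in> B0" "cmod (m' (h * k g)) \<le> cmod (m'' (h * k g))"
        using B0(2) m' unfolding is_boundary_def by blast
      then show ?thesis using small0[of m'' g] g B0c by (meson order_le_less_trans subsetD)
    qed
    obtain m2 where m2: "m2 \<in> B" "cmod (m1 h) \<le> cmod (m2 h)"
      using B(2) m1 unfolding is_boundary_def by blast
    then have m2h: "cmod (m2 h) \<ge> 1" using mh[OF m1(1)] m1 r by simp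
    have m2c: "m2 \<in> characters j" using m2 Bc by blast
    have "cmod (m2 g - m g) < e" if g: "g \<in> F" for g
    proof -
      have "1 * cmod (m2 g - m g) \<le> cmod (m2 h) * cmod (m2 g - m g)"
        by (intro mult_right_mono m2h) auto
      also have "\<dots> < e" using small[OF m2c g] m2c by (simp add: character_mult norm_mult mk)
      finally show ?thesis by simp
    qed
    then show False using e(2) m2(1) by blast
  qed
qed


lemma shilov_boundary_subset_characters:
  assumes "complex_banach_alg j" "characters j \<noteq> {}"
  shows "shilov_boundary j \<subseteq> characters j"
  using closed_characters is_boundary_characters[OF assms] unfolding shilov_boundary_def by blast

lemma closed_shilov_boundary: "closed (shilov_boundary j)"
  unfolding shilov_boundary_def by (rule closed_Inter) auto

lemma compact_shilov_boundary:
  assumes "complex_banach_alg j" "characters j \<noteq> {}"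
  shows "compact (shilov_boundary j)"
  using compact_characters[OF assms(1)] closed_shilov_boundary shilov_boundary_subset_characters[OF assms]
  by (metis compact_Int_closed inf.absorb2)

text \<open>An intersection of closed boundaries could a priori be empty; this one contains a
  minimal closed boundary, which lies in all the others.\<close>

lemma shilov_boundary_nonempty:
  assumes j: "complex_banach_alg j" and ne: "characters j \<noteq> {}"
  shows "shilov_boundary j \<noteq> {}"
proof -
  obtain B0 where B0: "closed B0" "is_boundary j B0"
    "\<And>B. closed B \<Longrightarrow> is_boundary j B \<Longrightarrow> B \<subseteq> B0 \<Longrightarrow> B = B0"
    using minimal_closed_boundary[OF j ne] by blast
  have "B0 \<subseteq> shilov_boundary j"
    unfolding shilov_boundary_def using minimal_boundary_subset_boundary[OF j B0] by blast
  moreover obtain m where "m \<in> B0"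
    using B0(2) unfolding is_boundary_def by blast
  ultimately show ?thesis by blast
qed

lemma semisimple_characters_nonempty:
  fixes j :: "'a::{real_normed_algebra_1,comm_ring_1,banach}"
  assumes "semisimple j"
  shows "characters j \<noteq> {}"
  using assms zero_neq_one[where 'a = 'a] unfolding semisimple_def by (metis empty_iff)

section \<open>Action of an automorphism on the boundary\<close>

lemma automorphism_inv:
  assumes "algebra_automorphism j U"
  shows "algebra_automorphism j (inv U)"
proof -
  have U: "bij U" "U 1 = 1" "\<And>x y. U (x + y) = U x + U y" "\<And>x y. U (x * y) = U x * U y"
     "\<And>c x. U (cscale j c x) = cscale j c (U x)"
    using assms by (auto simp: algebra_automorphism_def)
  have inv: "U (inv U x) = x" "inv U (U x) = x" for x
    using U(1) by (simp_all add: bij_is_surj surj_f_inv_f bij_is_inj)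
  have eqI: "x = y" if "U x = U y" for x y using that inv(2) by metis
  show ?thesis
    unfolding algebra_automorphism_def
    by (intro conjI allI bij_imp_bij_inv U(1); rule eqI) (simp_all add: inv U)
qed

lemma induced_map_character:
  assumes "algebra_automorphism j U" "m \<in> characters j"
  shows "induced_map U m \<in> characters j"
  using assms by (simp add: algebra_automorphism_def characters_def induced_map_def)

lemma induced_map_inverse:
  assumes "algebra_automorphism j U"
  shows "induced_map (inv U) (induced_map U m) = m" "induced_map U (induced_map (inv U) m) = m"
proof -
  have "bij U" using assms by (simp add: algebra_automorphism_def)
  then show "induced_map (inv U) (induced_map U m) = m" "induced_map U (induced_map (inv U) m) = m"
    by (simp_all add: induced_map_def o_def fun_eq_iff bij_is_surj surj_f_inv_f bij_is_inj)
qed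

lemma continuous_on_induced_map: "continuous_on X (induced_map U :: ('a \<Rightarrow> complex) \<Rightarrow> _)"
  unfolding induced_map_def o_def
  by (intro continuous_on_coordinatewise_then_product continuous_on_eval)

text \<open>A maximum point of \<open>inv U f\<close> in \<open>B\<close> is carried by the inverse
  map to one of \<open>f\<close>. This is what makes the intersection defining the Shilov boundary
  invariant.\<close>

lemma is_boundary_vimage_induced_map:
  assumes U: "algebra_automorphism j U" and B: "closed B" "is_boundary j B"
  shows "closed (induced_map U -` B)" "is_boundary j (induced_map U -` B)"
proof -
  show "closed (induced_map U -` B)"
    by (rule closed_vimage[OF B(1) continuous_on_induced_map])
  show "is_boundary j (induced_map U -` B)"
    unfolding is_boundary_def
  proof (intro conjI allI)
    show "induced_map U -` B \<subseteq> characters j"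
    proof
      fix m assume "m \<in> induced_map U -` B"
      then have "induced_map U m \<in> characters j" using B(2) by (auto simp: is_boundary_def)
      then have "induced_map (inv U) (induced_map U m) \<in> characters j"
        by (rule induced_map_character[OF automorphism_inv[OF U]])
      then show "m \<in> characters j" by (simp add: induced_map_inverse[OF U])
    qed
    fix f
    obtain m where m: "m \<in> B" "\<And>m'. m' \<in> characters j \<Longrightarrow> cmod (m' (inv U f)) \<le> cmod (m (inv U f))"
      using B(2) unfolding is_boundary_def by blast
    show "\<exists>m\<in>induced_map U -` B. \<forall>m'\<in>characters j. cmod (m' f) \<le> cmod (m f)"
    proof (intro bexI[of _ "induced_map (inv U) m"] ballI)
      show "induced_map (inv U) m \<in> induced_map U -` B"
        using m(1) by (simp add: induced_map_inverse[OF U])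
      fix m' assume "m' \<in> characters j"
      then have "cmod (induced_map U m' (inv U f)) \<le> cmod (m (inv U f))"
        by (intro m(2) induced_map_character[OF U])
      moreover have "U (inv U f) = f"
        using U by (simp add: algebra_automorphism_def bij_is_surj surj_f_inv_f)
      ultimately show "cmod (m' f) \<le> cmod (induced_map (inv U) m f)"
        by (simp add: induced_map_def)
    qed
  qed
qed

lemma induced_map_shilov_boundary:
  assumes U: "algebra_automorphism j U" and t: "t \<in> shilov_boundary j"
  shows "induced_map U t \<in> shilov_boundary j"
proof -
  have "induced_map U t \<in> B" if "closed B" "is_boundary j B" for B
    using is_boundary_vimage_induced_map[OF U that] t unfolding shilov_boundary_def by blast
  then show ?thesis unfolding shilov_boundary_def by blast
qed

section \<open>The algebra of boundary functions\<close>

lemma check_algebra_gelfand: "(\<lambda>t. if t \<in> shilov_boundary j then t f else 0) \<in> check_algebra j"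
  unfolding check_algebra_def by (auto intro!: exI[of _ f])

lemma check_algebra_approx:
  assumes "g \<in> check_algebra j" "e > 0"
  obtains f where "\<And>t. t \<in> shilov_boundary j \<Longrightarrow> cmod (g t - t f) < e"
  using assms unfolding check_algebra_def by blast

lemma check_algebra_bounded:
  assumes j: "complex_banach_alg j" and ne: "characters j \<noteq> {}" and g: "g \<in> check_algebra j"
  obtains K where "0 \<le> K" "\<And>t. cmod (g t) \<le> K"
proof -
  obtain f where f: "\<And>t. t \<in> shilov_boundary j \<Longrightarrow> cmod (g t - t f) < 1"
    using check_algebra_approx[OF g zero_less_one] by blast
  have "cmod (g t) \<le> 1 + norm f" for t
  proof (cases "t \<in> shilov_boundary j")
    case True
    then have "cmod (t f) \<le> norm f"
      using character_bound[OF j] shilov_boundary_subset_characters[OF j ne] by blast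
    moreover have "cmod (g t) \<le> cmod (g t - t f) + cmod (t f)"
      using norm_triangle_ineq[of "g t - t f" "t f"] by simp
    ultimately show ?thesis using f[OF True] by linarith
  next
    case False
    then show ?thesis using g by (simp add: check_algebra_def add_nonneg_nonneg)
  qed
  then show ?thesis by (intro that[of "1 + norm f"]) (auto simp: add_nonneg_nonneg)
qed

lemma check_algebra_add:
  assumes j: "complex_banach_alg j" and ne: "characters j \<noteq> {}"
    and g: "g \<in> check_algebra j" and h: "h \<in> check_algebra j"
  shows "(\<lambda>t. g t + h t) \<in> check_algebra j"
proof -
  have "\<exists>f. \<forall>t\<in>shilov_boundary j. cmod (g t + h t - t f) < e" if "e > 0" for e
  proof -
    have e2: "e/2 > 0" using that by simp
    obtain f1 where f1: "\<And>t. t \<in> shilov_boundary j \<Longrightarrow> cmod (g t - t f1) < e/2"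
      using check_algebra_approx[OF g e2] by blast
    obtain f2 where f2: "\<And>t. t \<in> shilov_boundary j \<Longrightarrow> cmod (h t - t f2) < e/2"
      using check_algebra_approx[OF h e2] by blast
    have "cmod (g t + h t - t (f1 + f2)) < e" if t: "t \<in> shilov_boundary j" for t
    proof -
      have "t (f1 + f2) = t f1 + t f2"
        using t shilov_boundary_subset_characters[OF j ne] by (intro character_add) auto
      then have "g t + h t - t (f1 + f2) = (g t - t f1) + (h t - t f2)" by simp
      then have "cmod (g t + h t - t (f1 + f2)) \<le> cmod (g t - t f1) + cmod (h t - t f2)"
        by (metis norm_triangle_ineq)
      then show ?thesis using f1[OF t] f2[OF t] by linarith
    qed
    then show ?thesis by blast
  qed
  then show ?thesis using g h by (simp add: check_algebra_def)
qed

lemma check_algebra_scale: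
  assumes j: "complex_banach_alg j" and ne: "characters j \<noteq> {}" and g: "g \<in> check_algebra j"
  shows "(\<lambda>t. c * g t) \<in> check_algebra j"
proof -
  have "\<exists>f. \<forall>t\<in>shilov_boundary j. cmod (c * g t - t f) < e" if "e > 0" for e
  proof -
    have "e / (cmod c + 1) > 0" using that by (simp add: add_nonneg_pos)
    then obtain f1 where f: "\<And>t. t \<in> shilov_boundary j \<Longrightarrow> cmod (g t - t f1) < e / (cmod c + 1)"
      using g unfolding check_algebra_def by blast
    have "cmod (c * g t - t (cscale j c f1)) < e" if t: "t \<in> shilov_boundary j" for t
    proof -
      have "t (cscale j c f1) = c * t f1"
        using t shilov_boundary_subset_characters[OF j ne] by (intro character_cscale) auto
      then have "cmod (c * g t - t (cscale j c f1)) = cmod c * cmod (g t - t f1)"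
        by (simp add: norm_mult flip: right_diff_distrib)
      also have "\<dots> \<le> (cmod c + 1) * cmod (g t - t f1)" by (intro mult_right_mono) auto
      also have "\<dots> < e" using f[OF t] by (simp add: pos_less_divide_eq add_nonneg_pos mult.commute)
      finally show ?thesis .
    qed
    then show ?thesis by blast
  qed
  then show ?thesis using g by (simp add: check_algebra_def)
qed

lemma check_algebra_diff:
  assumes j: "complex_banach_alg j" and ne: "characters j \<noteq> {}"
    and g: "g \<in> check_algebra j" and h: "h \<in> check_algebra j"
  shows "(\<lambda>t. g t - h t) \<in> check_algebra j"
  using check_algebra_add[OF j ne g check_algebra_scale[OF j ne h, of "-1"]] by simp

lemma check_algebra_uniform_closed:
  assumes "\<And>e. e > 0 \<Longrightarrow> \<exists>h\<in>check_algebra j. \<forall>t. cmod (g t - h t) < e"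
  shows "g \<in> check_algebra j"
proof -
  have "g t = 0" if t: "t \<notin> shilov_boundary j" for t
  proof (rule ccontr)
    assume "g t \<noteq> 0"
    then have "cmod (g t) > 0" by simp
    then obtain h where h: "h \<in> check_algebra j" "\<And>s. cmod (g s - h s) < cmod (g t)"
      using assms by blast
    have "h t = 0" using h(1) t by (simp add: check_algebra_def)
    then show False using h(2)[of t] by simp
  qed
  moreover have "\<exists>f. \<forall>t\<in>shilov_boundary j. cmod (g t - t f) < e" if "e > 0" for e
  proof -
    have e2: "e/2 > 0" using that by simp
    obtain h where h: "h \<in> check_algebra j" "\<And>t. cmod (g t - h t) < e/2"
      using assms[OF e2] by blast
    obtain f where f: "\<And>t. t \<in> shilov_boundary j \<Longrightarrow> cmod (h t - t f) < e/2"
      using h(1) e2 unfolding check_algebra_def by blast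
    have "cmod (g t - t f) < e" if "t \<in> shilov_boundary j" for t
      using h(2)[of t] f[OF that] norm_triangle_ineq[of "g t - h t" "h t - t f"] by simp
    then show ?thesis by blast
  qed
  ultimately show ?thesis by (simp add: check_algebra_def)
qed

text \<open>Powers of a peak function keep the value 1 at \<open>t\<close> and tend to 0 at finitely
  many other points. As the peak function lies only in the closure, a nearby element of the algebra
  is raised to the power instead. The bound 2 is independent of \<eta> and \<open>S\<close>.\<close>

lemma peak_point_approximation:
  assumes j: "complex_banach_alg j" and ne: "characters j \<noteq> {}"
    and t: "t \<in> shilov_boundary j" "peak_point j t"
    and S: "finite S" "S \<subseteq> shilov_boundary j - {t}" and \<eta>: "\<eta> > 0"
  obtains f where "cmod (t f - 1) \<le> \<eta>" "\<And>s. s \<in> shilov_boundary j \<Longrightarrow> cmod (s f) \<le> 2"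
    "\<And>s. s \<in> S \<Longrightarrow> cmod (s f) \<le> \<eta>"
proof -
  obtain g where g: "g \<in> check_algebra j" "g t = 1"
      "\<And>s. s \<in> shilov_boundary j \<Longrightarrow> s \<noteq> t \<Longrightarrow> cmod (g s) < 1"
    using t(2) unfolding peak_point_def by blast
  have g1: "cmod (g s) \<le> 1" if "s \<in> shilov_boundary j" for s
    using g(2) g(3)[OF that] by (cases "s = t") auto
  have "\<forall>\<^sub>F k in sequentially. \<forall>s\<in>S. cmod (g s) ^ k < \<eta>/2"
  proof (rule eventually_ball_finite[OF S(1)], rule ballI)
    fix s assume "s \<in> S"
    then have "cmod (g s) < 1" using S(2) by (intro g(3)) auto
    then have "(\<lambda>k. cmod (g s) ^ k) \<longlonglongrightarrow> 0" by (intro LIMSEQ_power_zero) simp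
    then show "\<forall>\<^sub>F k in sequentially. cmod (g s) ^ k < \<eta>/2"
      by (rule order_tendstoD) (use \<eta> in simp)
  qed
  then obtain k where k: "\<And>s. s \<in> S \<Longrightarrow> cmod (g s) ^ k < \<eta>/2"
    by (auto simp: eventually_sequentially)
  define e where "e = min (\<eta>/2) 1"
  have e: "e > 0" "e \<le> \<eta>/2" "e \<le> 1" using \<eta> by (auto simp: e_def)
  \<comment> \<open>The exponent \<open>k\<close> is fixed before \<open>f0\<close>, so that
    closeness of \<open>f0\<close> to \<open>g\<close> passes on to their powers.\<close>
  have "uniformly_continuous_on (cball 0 2) (\<lambda>z::complex. z ^ k)"
    by (intro compact_uniformly_continuous continuous_intros) auto
  then obtain d where d: "d > 0" "\<And>x y::complex. cmod x \<le> 2 \<Longrightarrow> cmod y \<le> 2 \<Longrightarrow> cmod (x - y) < d \<Longrightarrow> cmod (x ^ k - y ^ k) < e"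
    using e(1) unfolding uniformly_continuous_on_def by (fastforce simp: dist_norm)
  have "min d 1 > 0" using d by simp
  then obtain f0 where f0: "\<And>s. s \<in> shilov_boundary j \<Longrightarrow> cmod (g s - s f0) < min d 1"
    using g(1) unfolding check_algebra_def by blast
  have close: "cmod (s (f0 ^ k) - g s ^ k) < e" if s: "s \<in> shilov_boundary j" for s
  proof -
    have "cmod (s f0) \<le> 2"
      using f0[OF s] g1[OF s] norm_triangle_ineq2[of "s f0" "g s"] by (simp add: norm_minus_commute)
    moreover have "s (f0 ^ k) = s f0 ^ k"
      using s shilov_boundary_subset_characters[OF j ne] by (intro character_power) auto
    ultimately show ?thesis
      using d(2)[of "s f0" "g s"] f0[OF s] g1[OF s] by (simp add: norm_minus_commute)
  qed
  have gk: "cmod (s (f0 ^ k)) \<le> cmod (g s) ^ k + e" if s: "s \<in> shilov_boundary j" for s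
    using close[OF s] norm_triangle_ineq2[of "s (f0 ^ k)" "g s ^ k"] by (simp add: norm_power)
  show ?thesis
  proof (rule that[of "f0 ^ k"])
    show "cmod (t (f0 ^ k) - 1) \<le> \<eta>" using close[OF t(1)] g(2) e by simp
    show "cmod (s (f0 ^ k)) \<le> 2" if "s \<in> shilov_boundary j" for s
      using gk[OF that] power_le_one[OF norm_ge_zero g1[OF that], of k] e by linarith
    show "cmod (s (f0 ^ k)) \<le> \<eta>" if "s \<in> S" for s
      using gk[of s] k[OF that] that S(2) e by force
  qed
qed

section \<open>Boundedness of the inverse of the boundary operator\<close>

instance bcontfun :: (metric_space, banach) banach ..

text \<open>\<open>check_spectrum\<close> records mere bijectivity, so the sup-norm bound on the
  inverse has to come from the closed graph theorem.\<close>

lemma check_op_bounded_below: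
  assumes j: "complex_banach_alg j" and ne: "characters j \<noteq> {}"
    and U: "algebra_automorphism j U" and c: "c \<notin> check_spectrum j U w"
  obtains M where "M > 0" "\<And>g K t. g \<in> check_algebra j \<Longrightarrow> 0 \<le> K \<Longrightarrow>
     (\<And>t. t \<in> shilov_boundary j \<Longrightarrow> cmod (t w * g (induced_map U t) - c * g t) \<le> K) \<Longrightarrow> cmod (g t) \<le> M * K"
proof -
  let ?A = "check_algebra j"
  define D where "D g = (\<lambda>t. check_op j U w g t - c * g t)" for g
  have bij: "bij_betw D ?A ?A" using c unfolding check_spectrum_def D_def by simp
  define I where "I = inv_into ?A D"
  have IA: "I f \<in> ?A" and DI: "D (I f) = f" if "f \<in> ?A" for f
  proof -
    show "I f \<in> ?A"
      using bij_betw_inv_into[OF bij, THEN bij_betwE] that unfolding I_def by blast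
    show "D (I f) = f"
      unfolding I_def by (rule bij_betw_inv_into_right[OF bij that])
  qed
  have ID: "I (D g) = g" if "g \<in> ?A" for g
    using bij that unfolding I_def by (rule bij_betw_inv_into_left)
  have DA: "D g \<in> ?A" if "g \<in> ?A" for g using bij that bij_betwE by blast
  have D_add: "D (\<lambda>t. g t + h t) = (\<lambda>t. D g t + D h t)" for g h
    by (auto simp: D_def check_op_def algebra_simps)
  have D_scale: "D (\<lambda>t. r * g t) = (\<lambda>t. r * D g t)" for g r
    by (auto simp: D_def check_op_def algebra_simps)
  \<comment> \<open>Elements of the boundary algebra vanish off the boundary and are not continuous on the whole function
    space; the discrete topology makes them members of a Banach space type.\<close>
  define dec :: "(('a \<Rightarrow> complex) discrete \<Rightarrow>\<^sub>C complex) \<Rightarrow> ('a \<Rightarrow> complex) \<Rightarrow> complex"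
    where "dec F = (\<lambda>t. apply_bcontfun F (discrete t))" for F
  define enc :: "(('a \<Rightarrow> complex) \<Rightarrow> complex) \<Rightarrow> (('a \<Rightarrow> complex) discrete \<Rightarrow>\<^sub>C complex)"
    where "enc g = Bcontfun (\<lambda>d. g (of_discrete d))" for g
  have dec_enc: "dec (enc g) = g" if g: "g \<in> ?A" for g
  proof -
    obtain K where K: "\<And>t. cmod (g t) \<le> K" using check_algebra_bounded[OF j ne g] by blast
    have "(\<lambda>d. g (of_discrete d)) \<in> bcontfun"
      by (rule bcontfun_normI[of _ K]) (auto simp: K continuous_on_open_invariant open_discrete)
    then show ?thesis
      by (simp add: dec_def enc_def Bcontfun_inverse discrete_inverse)
  qed
  have dec_inj: "F = G" if "dec F = dec G" for F G
    using that unfolding dec_def by (metis bcontfun_eqI of_discrete_inverse)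
  have dec_add: "dec (F + G) = (\<lambda>t. dec F t + dec G t)" for F G by (simp add: dec_def)
  have dec_scale: "dec (r *\<^sub>R F) = (\<lambda>t. of_real r * dec F t)" for r F
    by (simp add: dec_def scaleR_conv_of_real)
  have dec_norm: "cmod (dec F t) \<le> norm F" for F t
    unfolding dec_def by (rule norm_bounded)
  have dec_diff: "dec (F - G) = (\<lambda>t. dec F t - dec G t)" for F G by (simp add: dec_def)
  define S where "S = {F. dec F \<in> ?A}"
  define R where "R F = enc (I (dec F))" for F
  have dec_R: "dec (R F) = I (dec F)" if "F \<in> S" for F
    using that by (simp add: R_def S_def dec_enc IA)
  have closedS: "closed S"
    unfolding closed_sequential_limits
  proof (intro allI impI, elim conjE)
    fix F l assume F: "\<forall>n. F n \<in> S" "F \<longlonglongrightarrow> l"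
    have "dec l \<in> ?A"
    proof (rule check_algebra_uniform_closed)
      fix e :: real assume "e > 0"
      then obtain n where n: "dist (F n) l < e"
        using F(2) unfolding lim_sequentially by blast
      have "cmod (dec l t - dec (F n) t) < e" for t
        using dec_norm[of "l - F n" t] n by (simp add: dec_diff dist_norm norm_minus_commute)
      then show "\<exists>h\<in>?A. \<forall>t. cmod (dec l t - h t) < e"
        using F(1) unfolding S_def by blast
    qed
    then show "l \<in> S" by (simp add: S_def)
  qed
  have "\<exists>M>0. \<forall>F\<in>S. norm (R F) \<le> M * norm F"
  proof (rule closed_graph_subspace_bounded)
    show "subspace S"
      unfolding subspace_def
    proof (intro conjI ballI allI)
      show "0 \<in> S"
        using check_algebra_scale[OF j ne check_algebra_gelfand, of 0 0] by (simp add: S_def dec_def)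
    qed (auto simp: S_def dec_add dec_scale check_algebra_add[OF j ne] check_algebra_scale[OF j ne])
    show "closed S" by (rule closedS)
    fix F G assume F: "F \<in> S" and G: "G \<in> S"
    have FG: "F + G \<in> S" using F G by (simp add: S_def dec_add check_algebra_add[OF j ne])
    have "I (dec (F + G)) = (\<lambda>t. I (dec F) t + I (dec G) t)"
    proof -
      have "D (\<lambda>t. I (dec F) t + I (dec G) t) = dec (F + G)"
        using F G by (simp add: D_add DI S_def dec_add)
      then show ?thesis
        using ID[OF check_algebra_add[OF j ne IA[of "dec F"] IA[of "dec G"]]] F G by (simp add: S_def)
    qed
    then show "R (F + G) = R F + R G"
      by (intro dec_inj) (simp add: dec_add dec_R F G FG)
  next
    fix r F assume F: "F \<in> S"
    have rF: "r *\<^sub>R F \<in> S" using F by (simp add: S_def dec_scale check_algebra_scale[OF j ne])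
    have "I (dec (r *\<^sub>R F)) = (\<lambda>t. of_real r * I (dec F) t)"
    proof -
      have "D (\<lambda>t. of_real r * I (dec F) t) = dec (r *\<^sub>R F)"
        using F by (simp add: D_scale DI S_def dec_scale)
      then show ?thesis
        using ID[OF check_algebra_scale[OF j ne IA[of "dec F"]]] F by (metis S_def mem_Collect_eq)
    qed
    then show "R (r *\<^sub>R F) = r *\<^sub>R R F"
      by (intro dec_inj) (simp add: dec_scale dec_R F rF)
  next
    fix F g assume F: "\<And>n. F n \<in> S" and F0: "F \<longlonglongrightarrow> 0" and Rg: "(\<lambda>n. R (F n)) \<longlonglongrightarrow> g"
    \<comment> \<open>Norm convergence gives pointwise convergence, and \<open>D\<close> at a point
      involves at most two values of its argument; this suffices to close the graph.\<close>
    have pt: "(\<lambda>n. dec (H n) t) \<longlonglongrightarrow> dec h t" if "H \<longlonglongrightarrow> h" for H h t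
    proof -
      have "(\<lambda>n. norm (H n - h)) \<longlonglongrightarrow> 0"
        using that by (simp add: LIM_zero tendsto_norm_zero)
      then have "(\<lambda>n. dec (H n - h) t) \<longlonglongrightarrow> 0"
        by (rule Lim_null_comparison[rotated]) (simp add: dec_norm)
      then show ?thesis by (simp add: dec_diff LIM_zero_cancel)
    qed
    have "R (F n) \<in> S" for n using dec_R[OF F] IA F by (simp add: S_def)
    then have gS: "g \<in> S" using closedS Rg by (metis closed_sequentially)
    have "D (dec g) t = 0" for t
    proof (rule LIMSEQ_unique)
      show "(\<lambda>n. D (dec (R (F n))) t) \<longlonglongrightarrow> D (dec g) t"
        unfolding D_def check_op_def by (auto intro!: tendsto_intros pt Rg)
      have "D (dec (R (F n))) t = dec (F n) t" for n
        using dec_R[OF F, of n] DI F by (simp add: S_def)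
      then show "(\<lambda>n. D (dec (R (F n))) t) \<longlonglongrightarrow> 0"
        using pt[OF F0, of t] by (simp add: dec_def)
    qed
    then have "D (dec g) = D (\<lambda>t. 0)" by (auto simp: D_def check_op_def fun_eq_iff)
    moreover have "(\<lambda>t. 0) \<in> ?A"
      using check_algebra_scale[OF j ne check_algebra_gelfand, of 0 0] by simp
    ultimately have "dec g = (\<lambda>t. 0)"
      using gS ID unfolding S_def by (metis mem_Collect_eq)
    then show "g = 0" by (intro dec_inj) (simp add: dec_def)
  qed
  then obtain M where M: "M > 0" "\<And>F. F \<in> S \<Longrightarrow> norm (R F) \<le> M * norm F" by blast
  show ?thesis
  proof (rule that[OF M(1)])
    fix g K t assume g: "g \<in> ?A" and K: "0 \<le> K" and le: "\<And>t. t \<in> shilov_boundary j \<Longrightarrow> cmod (t w * g (induced_map U t) - c * g t) \<le> K"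
    define F where "F = enc (D g)"
    have decF: "dec F = D g" using DA[OF g] by (simp add: F_def dec_enc)
    have FS: "F \<in> S" using decF DA[OF g] by (simp add: S_def)
    have "cmod (D g t) \<le> K" for t
      using le[of t] g K by (cases "t \<in> shilov_boundary j") (auto simp: D_def check_op_def check_algebra_def)
    then have "norm F \<le> K"
      using decF by (intro norm_bound) (metis dec_def of_discrete_inverse)
    have "cmod (g t) \<le> norm (R F)"
      using dec_norm[of "R F" t] dec_R[OF FS] ID[OF g] decF by simp
    also have "\<dots> \<le> M * norm F" by (rule M(2)[OF FS])
    also have "\<dots> \<le> M * K" using M(1) \<open>norm F \<le> K\<close> by (intro mult_left_mono) auto
    finally show "cmod (g t) \<le> M * K" .
  qed
qed

section \<open>Weighted orbits\<close>

text \<open>\<open>v\<close> is the cocycle of \<open>W / c\<close>, continued to negative indices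
  by reciprocals. With \<open>cmod c = exp L\<close> the two growth hypotheses bound it by 1 in each
  direction. Only the modulus of \<open>c\<close> enters, so one \<open>t\<close> serves a whole
  circle of values.\<close>

lemma two_sided_weighted_orbit:
  fixes W :: "'x \<Rightarrow> complex" and c :: complex
  assumes t: "t \<in> X"
    and \<phi>: "\<And>x. x \<in> X \<Longrightarrow> \<phi> x \<in> X" and \<psi>: "\<And>x. x \<in> X \<Longrightarrow> \<psi> x \<in> X"
    and inv: "\<And>x. x \<in> X \<Longrightarrow> \<phi> (\<psi> x) = x"
    and W: "\<And>x. x \<in> X \<Longrightarrow> W x \<noteq> 0" and c: "cmod c = exp L"
    and fwd: "\<And>n. (\<Sum>i<n. ln (cmod (W ((\<phi> ^^ i) t)))) \<le> real n * L"
    and bwd: "\<And>n. real n * L \<le> (\<Sum>i<n. ln (cmod (W ((\<phi> ^^ i) ((\<psi> ^^ n) t)))))"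
    and aper: "\<And>n. n \<ge> 1 \<Longrightarrow> (\<phi> ^^ n) t \<noteq> t"
  shows "\<exists>p v :: int \<Rightarrow> _. p 0 = t \<and> (\<forall>n. p n \<in> X) \<and> (\<forall>n. p (n + 1) = \<phi> (p n)) \<and>
    (\<forall>n. n \<noteq> 0 \<longrightarrow> p n \<noteq> t) \<and>
    v 0 = 1 \<and> (\<forall>n. v (n + 1) = v n * W (p n) / c) \<and> (\<forall>n. cmod (v n) \<le> 1)"
proof -
  have c0: "c \<noteq> 0" using c by auto
  have \<phi>n: "(\<phi> ^^ n) x \<in> X" if "x \<in> X" for n x using funpow_mem \<phi> that by metis
  have \<psi>n: "(\<psi> ^^ n) x \<in> X" if "x \<in> X" for n x using funpow_mem \<psi> that by metis
  define p where "p n = (if n \<ge> 0 then (\<phi> ^^ nat n) t else (\<psi> ^^ nat (- n)) t)" for n :: int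
  define v where "v n = (if n \<ge> 0 then \<Prod>i<nat n. W ((\<phi> ^^ i) t) / c
      else \<Prod>i<nat (- n). c / W ((\<phi> ^^ i) ((\<psi> ^^ nat (- n)) t)))" for n :: int
  have p_pos: "p (int k) = (\<phi> ^^ k) t" and p_neg: "p (- int k) = (\<psi> ^^ k) t" for k
    by (auto simp: p_def)
  have v_pos: "v (int k) = (\<Prod>i<k. W ((\<phi> ^^ i) t) / c)" for k
    by (simp add: v_def)
  have v_neg: "v (- int k) = (\<Prod>i<k. c / W ((\<phi> ^^ i) ((\<psi> ^^ k) t)))" for k
    by (cases "k = 0") (auto simp: v_def)
  have int_cases': thesis if "\<And>k. n = int k \<Longrightarrow> thesis" "\<And>k. n = - int (Suc k) \<Longrightarrow> thesis" for n thesis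
    using int_cases[of n] that by metis
  have cmod_prod: "cmod (\<Prod>i<k. W (y i) / c) = exp ((\<Sum>i<k. ln (cmod (W (y i)))) - real k * L)"
    if "\<And>i. y i \<in> X" for y :: "nat \<Rightarrow> 'x" and k
  proof -
    have "cmod (\<Prod>i<k. W (y i) / c) = (\<Prod>i<k. exp (ln (cmod (W (y i))) - L))"
      unfolding prod_norm[symmetric] using W[OF that] by (simp add: norm_divide c exp_diff)
    also have "\<dots> = exp (\<Sum>i<k. ln (cmod (W (y i))) - L)" by (simp add: exp_sum)
    finally show ?thesis by (simp add: sum_subtractf)
  qed
  show ?thesis
  proof (intro exI conjI allI impI)
    show "p 0 = t" "v 0 = 1" by (simp_all add: p_def v_def)
    fix n :: int
    show "p n \<in> X" using \<phi>n \<psi>n t by (simp add: p_def)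
    show "p (n + 1) = \<phi> (p n)"
    proof (cases rule: int_cases'[of n])
      case (1 k)
      then have "n + 1 = int (Suc k)" by simp
      then show ?thesis using p_pos[of "Suc k"] p_pos[of k] 1 by (simp add: add.commute)
    next
      case (2 k)
      then have "n + 1 = - int k" by simp
      then show ?thesis using p_neg[of "Suc k"] p_neg[of k] 2 inv[OF \<psi>n[OF t]] by simp
    qed
    show "v (n + 1) = v n * W (p n) / c"
    proof (cases rule: int_cases'[of n])
      case (1 k)
      then have "n + 1 = int (Suc k)" by simp
      then show ?thesis using v_pos[of "Suc k"] v_pos[of k] p_pos[of k] 1 by (simp add: add.commute)
    next
      case (2 k)
      let ?y = "(\<psi> ^^ Suc k) t"
      have shift: "(\<phi> ^^ Suc i) ?y = (\<phi> ^^ i) ((\<psi> ^^ k) t)" for i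
        using inv[OF \<psi>n[OF t]] by (simp add: funpow_swap1)
      have "v n = (\<Prod>i<Suc k. c / W ((\<phi> ^^ i) ?y))"
        using v_neg[of "Suc k"] 2 by simp
      \<comment> \<open>Peeling off the first factor leaves the product that starts one step later
        on the orbit, which is \<open>v (n + 1)\<close>.\<close>
      also have "\<dots> = c / W ?y * (\<Prod>i<k. c / W ((\<phi> ^^ Suc i) ?y))"
        by (subst prod.lessThan_Suc_shift) simp
      also have "(\<Prod>i<k. c / W ((\<phi> ^^ Suc i) ?y)) = v (n + 1)"
        unfolding shift using v_neg[of k] 2 by simp
      also have "?y = p n" using p_neg[of "Suc k"] 2 by simp
      finally show ?thesis using W[of "p n"] c0 \<psi>n[OF t, of "Suc k"] p_neg[of "Suc k"] 2 by simp
    qed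
    show "cmod (v n) \<le> 1"
    proof (cases rule: int_cases'[of n])
      case (1 k)
      have "cmod (v n) = exp ((\<Sum>i<k. ln (cmod (W ((\<phi> ^^ i) t)))) - real k * L)"
        unfolding 1 v_pos by (rule cmod_prod) (rule \<phi>n[OF t])
      then show ?thesis using fwd[of k] by simp
    next
      case (2 k)
      let ?y = "(\<psi> ^^ Suc k) t"
      \<comment> \<open>A value at a negative index is the reciprocal of a forward product started
        at \<open>?y\<close>, so the lower growth bound becomes an upper bound.\<close>
      have "v n = inverse (\<Prod>i<Suc k. W ((\<phi> ^^ i) ?y) / c)"
        unfolding 2 v_neg by (simp only: prod_dividef inverse_divide)
      then have "cmod (v n) = inverse (cmod (\<Prod>i<Suc k. W ((\<phi> ^^ i) ?y) / c))"
        by (simp only: norm_inverse)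
      also have "cmod (\<Prod>i<Suc k. W ((\<phi> ^^ i) ?y) / c)
          = exp ((\<Sum>i<Suc k. ln (cmod (W ((\<phi> ^^ i) ?y)))) - real (Suc k) * L)"
        by (rule cmod_prod) (rule \<phi>n[OF \<psi>n[OF t]])
      finally show ?thesis using bwd[of "Suc k"] by (simp only: exp_minus[symmetric] exp_le_one_iff)
    qed
    assume "n \<noteq> 0"
    show "p n \<noteq> t"
    proof (cases rule: int_cases'[of n])
      case (1 k)
      then show ?thesis using aper[of k] p_pos[of k] \<open>n \<noteq> 0\<close> by simp
    next
      case (2 k)
      \<comment> \<open>A return at a negative time, pushed forward by as many steps, would be a
        return at a positive time.\<close>
      have "(\<phi> ^^ m) ((\<psi> ^^ m) t) = t" for m
        using funpow_left_inverse[of X \<psi> \<phi> t m m] \<psi> inv t by simp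
      then show ?thesis using aper[of "Suc k"] p_neg[of "Suc k"] 2 by (metis le_add1 plus_1_eq_Suc)
    qed
  qed
qed

text \<open>The resolvent equation \<open>(T - c * z) g = c * f\<close>, read along the orbit \<open>p\<close> of \<open>t\<close> and weighted by the
  normalised cocycle \<open>v\<close>, becomes the recurrence \<open>b (n + 1) - z * b n = a n\<close> with \<open>a n = v n * p n f\<close>.\<close>

lemma orbit_resolvent_contradiction:
  fixes j w :: "'a::{real_normed_algebra_1,comm_ring_1,banach}" and p :: "int \<Rightarrow> 'a \<Rightarrow> complex"
  assumes j: "complex_banach_alg j" and ne: "characters j \<noteq> {}"
    and peak: "peak_point j (p 0)"
    and p: "\<And>n. p n \<in> shilov_boundary j" "\<And>n. p (n + 1) = induced_map U (p n)" "\<And>n. n \<noteq> 0 \<Longrightarrow> p n \<noteq> p 0"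
    and v: "v 0 = 1" "\<And>n. v (n + 1) = v n * p n w / c" "\<And>n. cmod (v n) \<le> 1" and c: "c \<noteq> 0"
    and s0: "0 < s0"
    and lip: "\<And>f s. (\<forall>t\<in>shilov_boundary j. cmod (t f) \<le> 2) \<Longrightarrow> 0 < s \<Longrightarrow> s < s0 \<Longrightarrow>
       \<exists>g g' K. (\<forall>t\<in>shilov_boundary j. cmod (g t) \<le> K \<and> cmod (g' t) \<le> K \<and>
            t w * g (induced_map U t) - c * exp (of_real s) * g t = c * t f \<and>
            t w * g' (induced_map U t) - c * exp (of_real (-s)) * g' t = c * t f) \<and>
          cmod (g (p 0) - g' (p 0)) \<le> C * s"
  shows False
proof -
  let ?X = "shilov_boundary j"
  \<comment> \<open>The admissible inputs come from elements with values at most 2 on the boundary;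
    their norm in the algebra is left free.\<close>
  define P where "P a \<longleftrightarrow> (\<exists>f. (\<forall>t\<in>?X. cmod (t f) \<le> 2) \<and> a = (\<lambda>n. v n * p n f))" for a
  show False
  proof (rule resolvent_jump_contradiction[of P s0 C])
    fix N :: nat and \<eta> :: real assume \<eta>: "0 < \<eta>"
    define S where "S = p ` ({- int N..int N} - {0})"
    have S: "finite S" "S \<subseteq> ?X - {p 0}" using p by (auto simp: S_def)
    obtain f where f: "cmod (p 0 f - 1) \<le> \<eta>" "\<And>s. s \<in> ?X \<Longrightarrow> cmod (s f) \<le> 2" "\<And>s. s \<in> S \<Longrightarrow> cmod (s f) \<le> \<eta>"
      using peak_point_approximation[OF j ne p(1) peak S \<eta>] by blast
    have le: "cmod (v n * p n f) \<le> cmod (p n f)" for n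
      using v(3)[of n] by (simp add: norm_mult mult_left_le_one_le)
    show "\<exists>a. P a \<and> cmod (a 0 - 1) \<le> \<eta> \<and> (\<forall>n. cmod (a n) \<le> 2) \<and>
        (\<forall>n. n \<noteq> 0 \<and> \<bar>n\<bar> \<le> int N \<longrightarrow> cmod (a n) \<le> \<eta>)"
    proof (intro exI[of _ "\<lambda>n. v n * p n f"] conjI allI impI)
      show "P (\<lambda>n. v n * p n f)" using f(2) unfolding P_def by blast
      show "cmod (v 0 * p 0 f - 1) \<le> \<eta>" using f(1) v(1) by simp
      show "cmod (v n * p n f) \<le> 2" for n using le[of n] f(2)[OF p(1)[of n]] by linarith
      fix n assume n: "n \<noteq> 0 \<and> \<bar>n\<bar> \<le> int N"
      then have "p n \<in> S" unfolding S_def by (intro imageI) auto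
      then show "cmod (v n * p n f) \<le> \<eta>" using le[of n] f(3) by (meson order_trans)
    qed
  next
    fix a s assume "P a" and s: "0 < s" "s < s0"
    then obtain f where f: "\<forall>t\<in>?X. cmod (t f) \<le> 2" and a: "a = (\<lambda>n. v n * p n f)"
      unfolding P_def by blast
    obtain g g' K where g: "\<And>t. t \<in> ?X \<Longrightarrow> cmod (g t) \<le> K" "\<And>t. t \<in> ?X \<Longrightarrow> cmod (g' t) \<le> K"
      "\<And>t. t \<in> ?X \<Longrightarrow> t w * g (induced_map U t) - c * exp (of_real s) * g t = c * t f"
      "\<And>t. t \<in> ?X \<Longrightarrow> t w * g' (induced_map U t) - c * exp (of_real (-s)) * g' t = c * t f"
      and gg': "cmod (g (p 0) - g' (p 0)) \<le> C * s"
      using lip[OF f s] by blast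
    have bdd: "bounded (range (\<lambda>n. v n * h (p n)))" if "\<And>t. t \<in> ?X \<Longrightarrow> cmod (h t) \<le> K" for h
    proof (rule boundedI[of _ K])
      fix x assume "x \<in> range (\<lambda>n. v n * h (p n))"
      then obtain n where "x = v n * h (p n)" by blast
      moreover have "cmod (v n) * cmod (h (p n)) \<le> 1 * K"
        using v(3)[of n] that[OF p(1)[of n]] by (intro mult_mono) auto
      ultimately show "cmod x \<le> K" by (simp add: norm_mult)
    qed
    have rec: "a n = v (n + 1) * h (p (n + 1)) - z * (v n * h (p n))"
      if h: "\<And>t. t \<in> ?X \<Longrightarrow> t w * h (induced_map U t) - c * z * h t = c * t f" for h z n
    proof -
      have "v (n + 1) * h (p (n + 1)) - z * (v n * h (p n))
          = v n / c * (p n w * h (induced_map U (p n)) - c * z * h (p n))"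
        unfolding v(2) p(2) using c by (simp add: field_simps)
      also have "\<dots> = a n" using c by (simp add: h[OF p(1)] a)
      finally show ?thesis by simp
    qed
    show "\<exists>b b'. bounded (range b) \<and> bounded (range b') \<and>
          (\<forall>n. a n = b (n + 1) - exp (of_real s) * b n) \<and>
          (\<forall>n. a n = b' (n + 1) - exp (of_real (-s)) * b' n) \<and> cmod (b 0 - b' 0) \<le> C * s"
      using bdd[of g] bdd[of g'] rec[of g] rec[of g'] g gg' v(1)
      by (intro exI[of _ "\<lambda>n. v n * g (p n)"] exI[of _ "\<lambda>n. v n * g' (p n)"]) auto
  qed (rule s0)
qed

lemma exp_minus_one_bound:
  fixes s :: real
  assumes "0 \<le> s" "s \<le> 1"
  shows "cmod (exp (of_real s) - 1) \<le> 2 * s" "cmod (exp (of_real (-s)) - 1) \<le> 2 * s"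
proof -
  have eq: "cmod (exp (of_real x) - 1) = \<bar>exp x - 1\<bar>" for x :: real
    by (metis exp_of_real norm_of_real of_real_1 of_real_diff)
  have "exp s \<le> 1 + s + s\<^sup>2" using assms by (rule exp_bound)
  moreover have "s\<^sup>2 \<le> s" using assms by (simp add: power2_eq_square mult_left_le)
  moreover have "1 + s \<le> exp s" by (rule exp_ge_add_one_self)
  moreover have "1 - s \<le> exp (- s)" using exp_ge_add_one_self[of "-s"] by simp
  moreover have "exp (- s) \<le> 1" using assms by simp
  ultimately show "cmod (exp (of_real s) - 1) \<le> 2 * s" "cmod (exp (of_real (-s)) - 1) \<le> 2 * s"
    unfolding eq using assms by linarith+
qed

text \<open>Off the unit circle \<open>c\<close> would lie outside the boundary spectrum. The
  bounded inverse at \<open>c\<close> then gives uniformly bounded solutions at nearby parameters,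
  differing by a multiple of the displacement, which is the Lipschitz behaviour excluded along the
  orbit.\<close>

lemma check_spectrum_orbit_radius:
  fixes j w :: "'a::{real_normed_algebra_1,comm_ring_1,banach}" and p :: "int \<Rightarrow> 'a \<Rightarrow> complex"
  assumes j: "complex_banach_alg j" and ne: "characters j \<noteq> {}"
    and U: "algebra_automorphism j U" and spec: "check_spectrum j U w \<subseteq> sphere 0 1"
    and peak: "peak_point j (p 0)"
    and p: "\<And>n. p n \<in> shilov_boundary j" "\<And>n. p (n + 1) = induced_map U (p n)" "\<And>n. n \<noteq> 0 \<Longrightarrow> p n \<noteq> p 0"
    and v: "v 0 = 1" "\<And>n. v (n + 1) = v n * p n w / c" "\<And>n. cmod (v n) \<le> 1" and c: "c \<noteq> 0"
  shows "cmod c = 1"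
proof (rule ccontr)
  assume c1: "cmod c \<noteq> 1"
  let ?X = "shilov_boundary j"
  have "c \<notin> check_spectrum j U w" using spec c1 by auto
  then obtain M where M: "M > 0" "\<And>g K t. g \<in> check_algebra j \<Longrightarrow> 0 \<le> K \<Longrightarrow>
     (\<And>t. t \<in> ?X \<Longrightarrow> cmod (t w * g (induced_map U t) - c * g t) \<le> K) \<Longrightarrow> cmod (g t) \<le> M * K"
    using check_op_bounded_below[OF j ne U] by blast
  define A where "A = 4 * M * cmod c"
  have A: "A > 0" using M c by (simp add: A_def)
  \<comment> \<open>The three terms serve the exponential estimate, keep \<open>c * exp x\<close>
    off the unit circle, and let the perturbation be absorbed.\<close>
  define s0 where "s0 = min 1 (min (\<bar>ln (cmod c)\<bar>) (1 / A))"
  have lnc: "ln (cmod c) \<noteq> 0" using c c1 by simp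
  have s0: "s0 > 0" "s0 \<le> 1" "s0 \<le> \<bar>ln (cmod c)\<bar>" "s0 \<le> 1 / A" using A lnc by (auto simp: s0_def)
  have solve: "\<exists>g\<in>check_algebra j. (\<forall>t. cmod (g t) \<le> A) \<and>
      (\<forall>t\<in>?X. t w * g (induced_map U t) - c * exp (of_real x) * g t = c * t f)"
    if f: "\<forall>t\<in>?X. cmod (t f) \<le> 2" and x: "0 < \<bar>x\<bar>" "\<bar>x\<bar> < s0" for f and x :: real
  proof -
    let ?l = "c * exp (of_real x)"
    have l1: "cmod ?l \<noteq> 1"
    proof
      assume "cmod ?l = 1"
      then have "cmod c * exp x = 1" by (simp add: norm_mult)
      then have "ln (cmod c) + x = 0" using c by (metis exp_ln ln_exp exp_not_eq_zero ln_mult_pos ln_one exp_gt_zero zero_less_norm_iff)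
      then show False using x s0(3) by linarith
    qed
    then have "bij_betw (\<lambda>g t. check_op j U w g t - ?l * g t) (check_algebra j) (check_algebra j)"
      using spec unfolding check_spectrum_def by fastforce
    moreover have "(\<lambda>t. c * (if t \<in> ?X then t f else 0)) \<in> check_algebra j"
      by (rule check_algebra_scale[OF j ne check_algebra_gelfand])
    ultimately obtain g where g: "g \<in> check_algebra j"
      "(\<lambda>t. check_op j U w g t - ?l * g t) = (\<lambda>t. c * (if t \<in> ?X then t f else 0))"
      unfolding bij_betw_def by (metis (no_types, lifting) imageE)
    have eq: "t w * g (induced_map U t) - ?l * g t = c * t f" if "t \<in> ?X" for t
      using fun_cong[OF g(2), of t] that by (simp add: check_op_def)
    obtain K0 where K0: "\<And>t. cmod (g t) \<le> K0" using check_algebra_bounded[OF j ne g(1)] by blast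
    define K where "K = (SUP t. cmod (g t))"
    have K: "cmod (g t) \<le> K" for t
      unfolding K_def by (rule cSUP_upper) (use K0 in \<open>auto simp: bdd_above_def\<close>)
    have K_nonneg: "K \<ge> 0" using order_trans[OF norm_ge_zero K] .
    have e: "cmod (exp (of_real x) - 1) \<le> 2 * \<bar>x\<bar>"
      using exp_minus_one_bound[of "\<bar>x\<bar>"] x s0(2) by (cases "x \<ge> 0") auto
    have "cmod (g t) \<le> M * (2 * cmod c + cmod c * (2 * \<bar>x\<bar>) * K)" for t
    proof (rule M(2)[OF g(1)])
      fix t assume t: "t \<in> ?X"
      have "t w * g (induced_map U t) - c * g t = c * t f + c * (exp (of_real x) - 1) * g t"
        using eq[OF t] by (simp add: algebra_simps)
      then have "cmod (t w * g (induced_map U t) - c * g t)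
          \<le> cmod c * cmod (t f) + cmod c * cmod (exp (of_real x) - 1) * cmod (g t)"
        by (metis norm_mult norm_triangle_ineq)
      also have "\<dots> \<le> cmod c * 2 + cmod c * (2 * \<bar>x\<bar>) * K"
        by (intro add_mono mult_mono f[rule_format] t e K order_refl) auto
      finally show "cmod (t w * g (induced_map U t) - c * g t) \<le> 2 * cmod c + cmod c * (2 * \<bar>x\<bar>) * K" by simp
    qed (use K_nonneg in auto)
    \<comment> \<open>\<open>K\<close> is already known to be finite;
      \<open>\<bar>x\<bar> \<le> 1 / A\<close> lets half of it be absorbed on the left, which leaves
      the uniform bound \<open>A\<close>.\<close>
    then have "K \<le> M * (2 * cmod c + cmod c * (2 * \<bar>x\<bar>) * K)"
      unfolding K_def by (intro cSUP_least) auto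
    also have "\<dots> = A / 2 + (A * \<bar>x\<bar>) / 2 * K" by (simp add: A_def algebra_simps)
    also have "A * \<bar>x\<bar> \<le> A * (1 / A)"
      using x s0(4) A by (intro mult_left_mono) auto
    then have "A * \<bar>x\<bar> \<le> 1" using A by simp
    then have "(A * \<bar>x\<bar>) / 2 * K \<le> 1 / 2 * K" using K_nonneg by (intro mult_right_mono) auto
    finally have "K \<le> A" by simp
    then show ?thesis using g(1) eq K by (intro bexI[of _ g]) (auto intro: order_trans)
  qed
  show False
  proof (rule orbit_resolvent_contradiction[OF j ne peak p v c s0(1), of "M * (4 * cmod c * A)"])
    fix f s assume f: "\<forall>t\<in>?X. cmod (t f) \<le> 2" and s: "0 < s" "s < s0"
    obtain g where g: "g \<in> check_algebra j" "\<And>t. cmod (g t) \<le> A"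
      "\<And>t. t \<in> ?X \<Longrightarrow> t w * g (induced_map U t) - c * exp (of_real s) * g t = c * t f"
      using solve[OF f, of s] s by auto
    obtain g' where g': "g' \<in> check_algebra j" "\<And>t. cmod (g' t) \<le> A"
      "\<And>t. t \<in> ?X \<Longrightarrow> t w * g' (induced_map U t) - c * exp (of_real (-s)) * g' t = c * t f"
      using solve[OF f, of "-s"] s by auto
    have e: "cmod (exp (of_real s) - 1) \<le> 2 * s" "cmod (exp (of_real (-s)) - 1) \<le> 2 * s"
      using exp_minus_one_bound[of s] s s0 by auto
    \<comment> \<open>The difference of the two solutions solves the equation at the common
      parameter \<open>c\<close> with a right-hand side of order \<open>s\<close>.\<close>
    have "cmod (g (p 0) - g' (p 0)) \<le> M * (4 * cmod c * A * s)"
    proof (rule M(2)[OF check_algebra_diff[OF j ne g(1) g'(1)]])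
      fix t assume t: "t \<in> ?X"
      have "t w * (g (induced_map U t) - g' (induced_map U t)) - c * (g t - g' t)
          = c * (exp (of_real s) - 1) * g t - c * (exp (of_real (-s)) - 1) * g' t"
        using g(3)[OF t] g'(3)[OF t] by (simp add: algebra_simps)
      then have "cmod (t w * (g (induced_map U t) - g' (induced_map U t)) - c * (g t - g' t))
          \<le> cmod c * cmod (exp (of_real s) - 1) * cmod (g t)
            + cmod c * cmod (exp (of_real (-s)) - 1) * cmod (g' t)"
        by (metis norm_mult norm_triangle_ineq4)
      also have "\<dots> \<le> cmod c * (2 * s) * A + cmod c * (2 * s) * A"
        using s by (intro add_mono mult_mono e g(2) g'(2) order_refl) auto
      finally show "cmod (t w * (g (induced_map U t) - g' (induced_map U t)) - c * (g t - g' t))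
          \<le> 4 * cmod c * A * s" by (simp add: mult_ac)
    qed (use s A in auto)
    then have diff: "cmod (g (p 0) - g' (p 0)) \<le> M * (4 * cmod c * A) * s" by (simp only: mult.assoc)
    show "\<exists>g g' K. (\<forall>t\<in>?X. cmod (g t) \<le> K \<and> cmod (g' t) \<le> K \<and>
            t w * g (induced_map U t) - c * exp (of_real s) * g t = c * t f \<and>
            t w * g' (induced_map U t) - c * exp (of_real (-s)) * g' t = c * t f) \<and>
          cmod (g (p 0) - g' (p 0)) \<le> M * (4 * cmod c * A) * s"
    proof (intro exI conjI ballI)
      fix t assume t: "t \<in> ?X"
      show "cmod (g t) \<le> A" "cmod (g' t) \<le> A" by (rule g(2) g'(2))+
      show "t w * g (induced_map U t) - c * exp (of_real s) * g t = c * t f" by (rule g(3)[OF t])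
      show "t w * g' (induced_map U t) - c * exp (of_real (-s)) * g' t = c * t f" by (rule g'(3)[OF t])
    qed (rule diff)
  qed
qed

section \<open>The resolvent on the Banach algebra\<close>

lemma cscale_add: "cscale j c (x + y) = cscale j c x + cscale j c y"
  by (simp add: cscale_def algebra_simps)

lemma cscale_cscale:
  assumes "complex_banach_alg j"
  shows "cscale j c (cscale j d x) = cscale j (c * d) x"
proof -
  have jj: "j * (j * x) = - x" for x
    using assms by (simp add: complex_banach_alg_def mult.assoc[symmetric])
  show ?thesis by (simp add: cscale_def algebra_simps jj)
qed

lemma bounded_linear_cscale:
  assumes "complex_banach_alg j"
  shows "bounded_linear (cscale j c)"
proof (rule bounded_linear_intro[where K = "cmod c"])
  show "norm (cscale j c x) \<le> norm x * cmod c" for x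
    by (simp add: norm_cscale[OF assms] mult.commute)
qed (simp_all add: cscale_def algebra_simps)

text \<open>\<open>algebra_automorphism\<close> contains no continuity, so the graph is closed
  through characters: each is continuous, so is its composite with \<open>U\<close>, and by
  semisimplicity they detect \<open>D g = 0\<close>.\<close>

lemma resolvent_bounded:
  assumes j: "complex_banach_alg j" and ss: "semisimple j" and U: "algebra_automorphism j U"
    and c: "c \<notin> alg_spectrum j (\<lambda>f. w * U f)"
  obtains R M where "bounded_linear R" "0 < M" "\<And>f. norm (R f) \<le> M * norm f"
    "\<And>d f. R (cscale j d f) = cscale j d (R f)" "\<And>f. w * U (R f) - cscale j c (R f) = f"
proof -
  define D where "D x = w * U x - cscale j c x" for x
  have bij: "bij D" using c unfolding alg_spectrum_def D_def by simp
  define R where "R = inv D"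
  have DR: "D (R f) = f" and RD: "R (D f) = f" for f
    using bij by (simp_all add: R_def bij_is_surj surj_f_inv_f bij_is_inj)
  have Uadd: "U (x + y) = U x + U y" and Usc: "U (cscale j d x) = cscale j d (U x)" for x y d
    using U by (simp_all add: algebra_automorphism_def)
  have Dadd: "D (x + y) = D x + D y" for x y
    by (simp add: D_def Uadd cscale_add algebra_simps)
  have Dsc: "D (cscale j d x) = cscale j d (D x)" for d x
  proof -
    have "w * cscale j d (U x) = cscale j d (w * U x)"
      by (simp add: cscale_def algebra_simps)
    moreover have "cscale j c (cscale j d x) = cscale j d (cscale j c x)"
      by (simp add: cscale_cscale[OF j] mult.commute)
    ultimately show ?thesis
      by (simp add: D_def Usc linear_diff[OF bounded_linear.linear[OF bounded_linear_cscale[OF j]]])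
  qed
  have Radd: "R (x + y) = R x + R y" for x y by (metis Dadd DR RD)
  have Rsc: "R (cscale j d x) = cscale j d (R x)" for d x by (metis Dsc DR RD)
  have Rscale: "R (r *\<^sub>R x) = r *\<^sub>R R x" for r x
    using Rsc[of "of_real r" x] by (simp add: cscale_of_real)
  have "\<exists>M>0. \<forall>x\<in>UNIV. norm (R x) \<le> M * norm x"
  proof (rule closed_graph_subspace_bounded)
    fix X g assume X: "X \<longlonglongrightarrow> 0" and g: "(\<lambda>n. R (X n)) \<longlonglongrightarrow> g"
    have "m (D g) = 0" if m: "m \<in> characters j" for m
    proof (rule LIMSEQ_unique)
      have mD: "m (D x) = m w * induced_map U m x - c * m x" for x
        using m by (simp add: D_def character_diff character_mult character_cscale induced_map_def)
      have "(\<lambda>n. induced_map U m (R (X n))) \<longlonglongrightarrow> induced_map U m g"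
        by (rule bounded_linear.tendsto[OF character_bounded_linear[OF j induced_map_character[OF U m]] g])
      moreover have "(\<lambda>n. m (R (X n))) \<longlonglongrightarrow> m g"
        by (rule bounded_linear.tendsto[OF character_bounded_linear[OF j m] g])
      ultimately show "(\<lambda>n. m (D (R (X n)))) \<longlonglongrightarrow> m (D g)"
        unfolding mD by (intro tendsto_intros)
      show "(\<lambda>n. m (D (R (X n)))) \<longlonglongrightarrow> 0"
        using bounded_linear.tendsto[OF character_bounded_linear[OF j m] X] character_zero[OF m]
        by (simp add: DR)
    qed
    then have "D g = 0" using ss unfolding semisimple_def by blast
    moreover have "R 0 = 0" using Rscale[of 0 0] by simp
    ultimately show "g = 0" using RD[of g] by simp
  qed (simp_all add: Radd Rscale)
  then obtain M where M: "M > 0" "\<And>x. norm (R x) \<le> M * norm x" by auto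
  have "bounded_linear R"
    by (rule bounded_linear_intro[where K = M]) (simp_all add: Radd Rscale M(2) mult.commute)
  then show ?thesis using that M Rsc DR unfolding D_def by blast
qed

text \<open>The Neumann series for \<open>(T - c - \<mu>) g = f\<close>, with \<open>R\<close> in
  the role of the inverse of \<open>T - c\<close>. Under a character it becomes a power series in
  \<mu> with coefficients independent of \<mu>, the source of holomorphy later.\<close>

lemma neumann_resolvent:
  assumes j: "complex_banach_alg j" and R: "bounded_linear R" "\<And>f. norm (R f) \<le> M * norm f" and M: "0 < M"
    and Rsc: "\<And>d f. R (cscale j d f) = cscale j d (R f)" and \<mu>: "cmod \<mu> * M < 1"
  obtains g where "g = R f + cscale j \<mu> (R g)"
    "\<And>m. m \<in> characters j \<Longrightarrow> (\<lambda>k. m ((R ^^ Suc k) f) * \<mu> ^ k) sums m g"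
proof -
  define x where "x k = cscale j (\<mu> ^ k) ((R ^^ Suc k) f)" for k
  have pow: "norm ((R ^^ k) f) \<le> M ^ k * norm f" for k
  proof (induction k)
    case (Suc k)
    have "norm ((R ^^ Suc k) f) \<le> M * norm ((R ^^ k) f)" using R(2) by simp
    also have "\<dots> \<le> M * (M ^ k * norm f)" using M Suc by (intro mult_left_mono) auto
    finally show ?case by (simp add: mult.assoc)
  qed simp
  have geo: "summable (\<lambda>k. (M * norm f) * (cmod \<mu> * M) ^ k)"
    using M \<mu> by (intro summable_mult summable_geometric) auto
  have "norm (x k) \<le> (M * norm f) * (cmod \<mu> * M) ^ k" for k
  proof -
    have "norm (x k) \<le> cmod \<mu> ^ k * (M ^ Suc k * norm f)"
      unfolding x_def norm_cscale[OF j] norm_power by (intro mult_left_mono pow) auto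
    then show ?thesis by (simp add: power_mult_distrib mult_ac)
  qed
  then have "summable (\<lambda>k. norm (x k))"
    by (intro summable_comparison_test[OF _ geo]) auto
  then have summ: "summable x" by (rule summable_norm_cancel)
  define g where "g = suminf x"
  have xg: "x sums g" using summ by (simp add: g_def summable_sums)
  have "(\<lambda>k. cscale j \<mu> (R (x k))) sums cscale j \<mu> (R g)"
    by (intro bounded_linear.sums[OF bounded_linear_cscale[OF j]] bounded_linear.sums[OF R(1)] xg)
  moreover have "cscale j \<mu> (R (x k)) = x (Suc k)" for k
    by (simp add: x_def Rsc cscale_cscale[OF j])
  ultimately have "(\<lambda>k. x (Suc k)) sums cscale j \<mu> (R g)" by simp
  then have "x sums (cscale j \<mu> (R g) + x 0)" by (simp add: sums_Suc_iff)
  then have "g = cscale j \<mu> (R g) + x 0" by (rule sums_unique2[OF xg])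
  then have "g = R f + cscale j \<mu> (R g)" by (simp add: x_def add.commute)
  moreover have "(\<lambda>k. m ((R ^^ Suc k) f) * \<mu> ^ k) sums m g" if m: "m \<in> characters j" for m
    using bounded_linear.sums[OF character_bounded_linear[OF j m] xg] m
    by (simp add: x_def character_cscale mult.commute)
  ultimately show ?thesis using that by blast
qed

text \<open>Compares the distance of \<open>exp \<zeta>\<close> from the unit circle with the real
  part of \<zeta>.\<close>

lemma abs_exp_minus_one_ge:
  fixes x :: real
  assumes "\<bar>x\<bar> \<le> 1"
  shows "\<bar>x\<bar> / 2 \<le> \<bar>exp x - 1\<bar>"
proof (cases "x \<ge> 0")
  case True
  have "1 + x \<le> exp x" by (rule exp_ge_add_one_self)
  then show ?thesis using True by linarith
next
  case False
  have "1 - x \<le> exp (- x)" using exp_ge_add_one_self[of "-x"] by simp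
  then have "exp x * (1 - x) \<le> exp x * exp (- x)" by (intro mult_left_mono) auto
  then have "exp x * (1 - x) \<le> 1" by (simp flip: exp_add)
  moreover have "1 \<le> (1 + x / 2) * (1 - x)"
  proof -
    have "(- x) * (1 + x) \<ge> 0" using False assms by (intro mult_nonneg_nonneg) auto
    then show ?thesis by (simp add: algebra_simps)
  qed
  ultimately have "exp x * (1 - x) \<le> (1 + x / 2) * (1 - x)" by linarith
  then have "exp x \<le> 1 + x / 2" using False by simp
  then show ?thesis using False by simp
qed

text \<open>Outside the spectrum of \<open>T\<close> the resolvent is controlled by the algebra
  norm, which is not bounded over the peak functions used. The orbit recurrence supplies a bound by
  boundary values on a small circle around \<open>c\<close> in logarithmic coordinates, and
  holomorphy carries it to the centre as a Lipschitz estimate.\<close>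

lemma unit_circle_point_in_spectrum:
  fixes j w :: "'a::{real_normed_algebra_1,comm_ring_1,banach}" and p :: "int \<Rightarrow> 'a \<Rightarrow> complex"
  assumes j: "complex_banach_alg j" and ss: "semisimple j" and U: "algebra_automorphism j U"
    and peak: "peak_point j (p 0)"
    and p: "\<And>n. p n \<in> shilov_boundary j" "\<And>n. p (n + 1) = induced_map U (p n)" "\<And>n. n \<noteq> 0 \<Longrightarrow> p n \<noteq> p 0"
    and v: "v 0 = 1" "\<And>n. v (n + 1) = v n * p n w / c" "\<And>n. cmod (v n) \<le> 1" and c: "cmod c = 1"
  shows "c \<in> alg_spectrum j (\<lambda>f. w * U f)"
proof (rule ccontr)
  assume "c \<notin> alg_spectrum j (\<lambda>f. w * U f)"
  then obtain R M where R: "bounded_linear R" "\<And>f. norm (R f) \<le> M * norm f" and M: "0 < M"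
    and Rsc: "\<And>d f. R (cscale j d f) = cscale j d (R f)"
    and DR: "\<And>f. w * U (R f) - cscale j c (R f) = f"
    using resolvent_bounded[OF j ss U] by metis
  have ne: "characters j \<noteq> {}" using ss by (rule semisimple_characters_nonempty)
  let ?X = "shilov_boundary j"
  have Xc: "t \<in> characters j" if "t \<in> ?X" for t
    using that shilov_boundary_subset_characters[OF j ne] by blast
  have c0: "c \<noteq> 0" using c by auto
  \<comment> \<open>Displacement from \<open>c\<close> to \<open>c * exp \<zeta>\<close>; in this
    coordinate the unit circle becomes the imaginary axis.\<close>
  define \<mu> where "\<mu> \<zeta> = c * (exp \<zeta> - 1)" for \<zeta> :: complex
  have "((\<lambda>\<zeta>. cmod (exp \<zeta> - 1) * M) \<longlongrightarrow> cmod (exp 0 - 1) * M) (at (0::complex))"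
    by (intro tendsto_intros)
  then have "\<forall>\<^sub>F \<zeta> in at (0::complex). cmod (exp \<zeta> - 1) * M < 1"
    by (rule order_tendstoD) simp
  then obtain r1 where r1: "r1 > 0" "\<And>\<zeta>::complex. \<zeta> \<noteq> 0 \<Longrightarrow> cmod \<zeta> < r1 \<Longrightarrow> cmod (exp \<zeta> - 1) * M < 1"
    unfolding eventually_at by (auto simp: dist_norm)
  define r where "r = min r1 1"
  have r: "r > 0" "r \<le> 1" using r1 by (auto simp: r_def)
  have \<mu>: "cmod (\<mu> \<zeta>) * M < 1" if "cmod \<zeta> < r" for \<zeta>
    using r1(2)[of \<zeta>] that M c by (cases "\<zeta> = 0") (auto simp: \<mu>_def norm_mult r_def)
  define \<rho> where "\<rho> = r / 2"
  have \<rho>: "0 < \<rho>" "\<rho> < r" using r by (auto simp: \<rho>_def)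
  show False
  proof (rule orbit_resolvent_contradiction[OF j ne peak p v c0 \<rho>(1), of "4 * 4 / \<rho>\<^sup>2"])
    fix f s assume f: "\<forall>t\<in>?X. cmod (t f) \<le> 2" and s: "0 < s" "s < \<rho>"
    define h where "h = cscale j c f"
    have "\<exists>g. g = R h + cscale j (\<mu> \<zeta>) (R g) \<and>
        (\<forall>m\<in>characters j. (\<lambda>k. m ((R ^^ Suc k) h) * \<mu> \<zeta> ^ k) sums m g)" if "cmod \<zeta> < r" for \<zeta>
      using neumann_resolvent[OF j R M Rsc \<mu>[OF that], of h] by metis
    then obtain g where g: "\<And>\<zeta>. cmod \<zeta> < r \<Longrightarrow> g \<zeta> = R h + cscale j (\<mu> \<zeta>) (R (g \<zeta>))"
       "\<And>\<zeta> m. cmod \<zeta> < r \<Longrightarrow> m \<in> characters j \<Longrightarrow> (\<lambda>k. m ((R ^^ Suc k) h) * \<mu> \<zeta> ^ k) sums m (g \<zeta>)"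
      by metis
    have eq: "t w * induced_map U t (g \<zeta>) - c * exp \<zeta> * t (g \<zeta>) = c * t f"
      if t: "t \<in> ?X" and \<zeta>: "cmod \<zeta> < r" for t \<zeta>
    proof -
      have "g \<zeta> = R (h + cscale j (\<mu> \<zeta>) (g \<zeta>))"
        using g(1)[OF \<zeta>] Rsc bounded_linear.linear[OF R(1)] by (simp add: linear_add)
      then have "w * U (g \<zeta>) - cscale j c (g \<zeta>) = h + cscale j (\<mu> \<zeta>) (g \<zeta>)"
        using DR by metis
      then have "t (w * U (g \<zeta>) - cscale j c (g \<zeta>)) = t (h + cscale j (\<mu> \<zeta>) (g \<zeta>))" by simp
      then have "t w * t (U (g \<zeta>)) - c * t (g \<zeta>) = c * t f + \<mu> \<zeta> * t (g \<zeta>)"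
        using Xc[OF t] by (simp add: character_diff character_mult character_cscale character_add h_def)
      then show ?thesis by (simp add: induced_map_def \<mu>_def algebra_simps)
    qed
    define G where "G \<zeta> = p 0 (g \<zeta>)" for \<zeta>
    define a where "a k = p 0 ((R ^^ Suc k) h)" for k
    have "(\<lambda>z. \<Sum>k. a k * (z - 0) ^ k) holomorphic_on ball 0 (1 / M)"
    proof (rule power_series_holomorphic)
      fix z :: complex assume "z \<in> ball 0 (1 / M)"
      then have z: "cmod z * M < 1" using M by (simp add: field_simps)
      obtain y where "\<And>m. m \<in> characters j \<Longrightarrow> (\<lambda>k. m ((R ^^ Suc k) h) * z ^ k) sums m y"
        using neumann_resolvent[OF j R M Rsc z, of h] by metis
      from this[OF Xc[OF p(1)]] show "(\<lambda>k. a k * (z - 0) ^ k) sums (\<Sum>k. a k * (z - 0) ^ k)"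
        by (simp add: a_def sums_iff)
    qed
    moreover have "\<mu> holomorphic_on ball 0 r" unfolding \<mu>_def by (intro holomorphic_intros)
    moreover have "\<mu> ` ball 0 r \<subseteq> ball 0 (1 / M)"
      using \<mu> M by (auto simp: pos_less_divide_eq)
    ultimately have "((\<lambda>z. \<Sum>k. a k * (z - 0) ^ k) \<circ> \<mu>) holomorphic_on ball 0 r"
      by (intro holomorphic_on_compose_gen)
    moreover have "((\<lambda>z. \<Sum>k. a k * (z - 0) ^ k) \<circ> \<mu>) \<zeta> = G \<zeta>" if "\<zeta> \<in> ball 0 r" for \<zeta>
      using g(2)[of \<zeta> "p 0"] Xc[OF p(1)] that by (simp add: a_def G_def sums_iff)
    ultimately have hol: "G holomorphic_on ball 0 r"
      by (rule holomorphic_transform)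
    have bound: "cmod (G \<zeta>) \<le> 4 / \<bar>Re \<zeta>\<bar>" if \<zeta>: "cmod \<zeta> = \<rho>" "Re \<zeta> \<noteq> 0" for \<zeta>
    proof -
      have \<zeta>r: "cmod \<zeta> < r" using \<zeta> \<rho> by simp
      have "cmod (v 0 * p 0 (g \<zeta>)) \<le> 2 / \<bar>cmod (exp \<zeta>) - 1\<bar>"
      proof (rule bounded_recurrence_bound[of "\<lambda>n. v n * p n f"])
        fix n
        show "v n * p n f = v (n + 1) * p (n + 1) (g \<zeta>) - exp \<zeta> * (v n * p n (g \<zeta>))"
        proof -
          have "v (n + 1) * p (n + 1) (g \<zeta>) - exp \<zeta> * (v n * p n (g \<zeta>))
              = v n / c * (p n w * induced_map U (p n) (g \<zeta>) - c * exp \<zeta> * p n (g \<zeta>))"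
            unfolding v(2) p(2) using c0 by (simp add: field_simps)
          also have "\<dots> = v n * p n f" using c0 by (simp add: eq[OF p(1) \<zeta>r])
          finally show ?thesis by simp
        qed
        have "cmod (v n) * cmod (p n f) \<le> 1 * 2"
          using v(3)[of n] f p(1)[of n] by (intro mult_mono) auto
        then show "cmod (v n * p n f) \<le> 2" by (simp add: norm_mult)
      next
        \<comment> \<open>The algebra norm of \<open>g \<zeta>\<close> enters only to make the
          sequence bounded; its size does not affect the estimate.\<close>
        show "bounded (range (\<lambda>n. v n * p n (g \<zeta>)))"
        proof (rule boundedI[of _ "norm (g \<zeta>)"])
          fix x assume "x \<in> range (\<lambda>n. v n * p n (g \<zeta>))"
          then obtain n where "x = v n * p n (g \<zeta>)" by blast
          moreover have "cmod (v n) * cmod (p n (g \<zeta>)) \<le> 1 * norm (g \<zeta>)"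
            using v(3)[of n] character_bound[OF j Xc[OF p(1)[of n]]] by (intro mult_mono) auto
          ultimately show "cmod x \<le> norm (g \<zeta>)" by (simp add: norm_mult)
        qed
        show "cmod (exp \<zeta>) \<noteq> 1" using \<zeta> by simp
      qed
      then have "cmod (G \<zeta>) \<le> 2 / \<bar>exp (Re \<zeta>) - 1\<bar>" by (simp add: G_def v(1))
      also have "\<dots> \<le> 2 / (\<bar>Re \<zeta>\<bar> / 2)"
      proof (rule divide_left_mono)
        show "\<bar>Re \<zeta>\<bar> / 2 \<le> \<bar>exp (Re \<zeta>) - 1\<bar>"
          using abs_Re_le_cmod[of \<zeta>] \<zeta>r r by (intro abs_exp_minus_one_ge) linarith
      qed (use \<zeta> in auto)
      finally show ?thesis by simp
    qed
    have "cmod (G (of_real s) - G (of_real (-s))) \<le> 4 * 4 * s / \<rho>\<^sup>2"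
      by (rule holomorphic_odd_difference_bound[OF hol \<rho> bound]) (use s in auto)
    then have diff: "cmod (p 0 (g (of_real s)) - p 0 (g (of_real (-s)))) \<le> 4 * 4 / \<rho>\<^sup>2 * s"
      by (simp add: G_def)
    define K where "K = max (norm (g (of_real s))) (norm (g (of_real (-s))))"
    have sr: "cmod (of_real s) < r" "cmod (of_real (-s)) < r" using s \<rho> by auto
    show "\<exists>g g' K. (\<forall>t\<in>?X. cmod (g t) \<le> K \<and> cmod (g' t) \<le> K \<and>
            t w * g (induced_map U t) - c * exp (of_real s) * g t = c * t f \<and>
            t w * g' (induced_map U t) - c * exp (of_real (-s)) * g' t = c * t f) \<and>
          cmod (g (p 0) - g' (p 0)) \<le> 4 * 4 / \<rho>\<^sup>2 * s"
    proof (intro exI conjI ballI)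
      fix t assume t: "t \<in> ?X"
      show "cmod (t (g (of_real s))) \<le> K" "cmod (t (g (of_real (-s)))) \<le> K"
        using character_bound[OF j Xc[OF t]] unfolding K_def by (auto intro: max.coboundedI1 max.coboundedI2)
      show "t w * induced_map U t (g (of_real s)) - c * exp (of_real s) * t (g (of_real s)) = c * t f"
        by (rule eq[OF t sr(1)])
      show "t w * induced_map U t (g (of_real (-s))) - c * exp (of_real (-s)) * t (g (of_real (-s))) = c * t f"
        by (rule eq[OF t sr(2)])
    qed (rule diff)
  qed
qed

section \<open>Spectral inclusion from a maximal orbit\<close>

theorem theorem3:
  fixes j w :: "'a::{real_normed_algebra_1,comm_ring_1,banach}" and U :: "'a \<Rightarrow> 'a"
  assumes "complex_banach_alg j"
    and "semisimple j"
    and "algebra_automorphism j U"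
    and "\<forall>n\<ge>1. U ^^ n \<noteq> id"
    and "check_spectrum j U w \<subseteq> sphere 0 1"
    and "\<forall>t\<in>shilov_boundary j. \<not> periodic_point U t"
    and "\<forall>t\<in>shilov_boundary j. peak_point j t"
  shows "sphere (0::complex) 1 \<subseteq> alg_spectrum j (\<lambda>f. w * U f)"
proof
  fix c :: complex assume "c \<in> sphere 0 1"
  then have c: "cmod c = 1" by simp
  note j = assms(1) and ss = assms(2) and U = assms(3)
  have ne: "characters j \<noteq> {}" using ss by (rule semisimple_characters_nonempty)
  let ?X = "shilov_boundary j" and ?\<phi> = "induced_map U :: ('a \<Rightarrow> complex) \<Rightarrow> _"
    and ?\<psi> = "induced_map (inv U) :: ('a \<Rightarrow> complex) \<Rightarrow> _"
  have \<phi>: "\<And>t. t \<in> ?X \<Longrightarrow> ?\<phi> t \<in> ?X" and \<psi>: "\<And>t. t \<in> ?X \<Longrightarrow> ?\<psi> t \<in> ?X"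
    by (simp_all add: induced_map_shilov_boundary[OF U] induced_map_shilov_boundary[OF automorphism_inv[OF U]])
  \<comment> \<open>Since 0 is off the unit circle, the boundary operator is onto and attains the
    restriction of the unit, so \<open>w\<close> cannot vanish on the boundary.\<close>
  have w0: "t w \<noteq> 0" if t: "t \<in> ?X" for t
  proof -
    have "bij_betw (\<lambda>g t. check_op j U w g t - 0 * g t) (check_algebra j) (check_algebra j)"
      using assms(5) unfolding check_spectrum_def by fastforce
    then obtain g where "(\<lambda>t. check_op j U w g t - 0 * g t) = (\<lambda>t. if t \<in> ?X then t 1 else 0)"
      using check_algebra_gelfand[of j 1] unfolding bij_betw_def by (metis (no_types, lifting) imageE)
    from fun_cong[OF this, of t] have "t w * g (?\<phi> t) = t 1"
      using t by (simp add: check_op_def)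
    also have "t 1 = 1"
      using t shilov_boundary_subset_characters[OF j ne] by (auto intro: character_one)
    finally show ?thesis by auto
  qed
  have cont: "continuous_on ?X (\<lambda>t. ln (cmod (t w)))"
    by (intro continuous_intros continuous_on_eval) (use w0 in auto)
  obtain t L where t: "t \<in> ?X"
    and fwd: "\<And>n. (\<Sum>i<n. ln (cmod ((?\<phi> ^^ i) t w))) \<le> real n * L"
    and bwd: "\<And>n. real n * L \<le> (\<Sum>i<n. ln (cmod ((?\<phi> ^^ i) ((?\<psi> ^^ n) t) w)))"
    by (rule two_sided_birkhoff_maximum[of ?X ?\<phi> ?\<psi> "\<lambda>t. ln (cmod (t w))",
        OF compact_shilov_boundary[OF j ne] closed_shilov_boundary shilov_boundary_nonempty[OF j ne]
        continuous_on_induced_map \<phi> continuous_on_induced_map \<psi> induced_map_inverse(1)[OF U] cont]; (assumption | rule that))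
  have aper: "(?\<phi> ^^ n) t \<noteq> t" if "n \<ge> 1" for n
    using assms(6) t that unfolding periodic_point_def by blast
  have peak: "peak_point j t" using assms(7) t by blast
  define orbit where "orbit d p v \<longleftrightarrow> p 0 = t \<and> (\<forall>n. p n \<in> ?X) \<and> (\<forall>n. p (n + 1) = ?\<phi> (p n)) \<and>
      (\<forall>n. n \<noteq> 0 \<longrightarrow> p n \<noteq> t) \<and> v 0 = 1 \<and> (\<forall>n. v (n + 1) = v n * p n w / d) \<and> (\<forall>n. cmod (v n) \<le> 1)"
    for d :: complex and p :: "int \<Rightarrow> 'a \<Rightarrow> complex" and v :: "int \<Rightarrow> complex"
  have orbit: "\<exists>p v. orbit d p v" if "cmod d = exp L" for d
    unfolding orbit_def
    by (rule two_sided_weighted_orbit[of t ?X ?\<phi> ?\<psi> "\<lambda>t. t w" d L])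
       (use t \<phi> \<psi> induced_map_inverse(2)[OF U] w0 that fwd bwd aper in auto)
  \<comment> \<open>The orbit is first normalised by the positive number \<open>exp L\<close>, which
    is thereby shown to be 1; then the unimodular \<open>c\<close> itself can normalise an
    orbit.\<close>
  obtain p v where "orbit (of_real (exp L)) p v" using orbit[of "of_real (exp L)"] by auto
  then have "cmod (of_real (exp L)) = 1"
    using peak unfolding orbit_def
    by (intro check_spectrum_orbit_radius[OF j ne U assms(5), of p v]) auto
  then have "cmod c = exp L" using c by simp
  then obtain p v where "orbit c p v" using orbit by blast
  then show "c \<in> alg_spectrum j (\<lambda>f. w * U f)"
    using peak c unfolding orbit_def
    by (intro unit_circle_point_in_spectrum[OF j ss U, of p v]) auto
qed

end
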